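(* Let $w$ be a non-negative, locally integrable function on $\mathbb{R}$. Then the following hold. (i) If $w\in A_\infty^+$ then for $0<\epsilon\le \frac{1}{2[w]_{A_\infty^+}}$ and for all $a<b<c$ we have the one-sided reverse Hölder inequality $$|(b,c)|^\epsilon\int_{(a,b)}w^{1+\epsilon}\le 2\bigg(\int_{(a,c)}w\bigg)^{1+\epsilon}.$$ (ii) If $w\in A_\infty^+$ then for $0<\epsilon\le \frac{1}{2[w]_{A_\infty^+}}$ and for all $a<b<c$ and for all measurable sets $E\subseteq(a,b)$ we have $$\frac{w(E)}{w(a,c)}\le 2\Big(\frac{|E|}{|(b,c)|}\Big)^{\frac{\epsilon}{1+\epsilon}}\le 2\Big(\frac{|E|}{|(b,c)|}\Big)^{\frac{1}{3[w]_{A_\infty^+}}}.$$ (iii) Conversely, if the conclusion of (i) or (ii) holds for some $0<\epsilon<1$ then $w\in A_\infty^+$ and $[w]_{A_\infty^+}\lesssim \frac{1}{\epsilon}$; thus (i), (ii) are best possible up to numerical constants.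
   Context: Write $|E|$ for the Lebesgue measure of a measurable set $E\subseteq\mathbb{R}$, $w(E)=\int_E w(t)\,dt$, $w(a,b)=\int_{(a,b)}w(t)\,dt$, and $\mathbf{1}_E$ for the indicator function of $E$. For $f\in L^1_{\mathrm{loc}}(\mathbb{R})$ the backward one-sided Hardy-Littlewood maximal operator is $$\mathsf{M}^-f(x)=\sup_{h>0}\frac1h\int_{x-h}^{x}|f(t)|\,dt,\qquad x\in\mathbb{R}.$$ The (Fujii-Wilson type) one-sided $A_\infty^+$ constant of $w$ is $$[w]_{A_\infty^+}=\sup_{a<b}\frac{1}{w(a,b)}\int_{(a,b)}\mathsf{M}^-(w\mathbf{1}_{(a,b)})(x)\,dx,$$ and $w\in A_\infty^+$ means $[w]_{A_\infty^+}<+\infty$. The notation $A\lesssim B$ means $A\le CB$ for some numerical constant $C>0$.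
   Formalization: In (ii) the second inequality, false for general ε (w=1, ε=1/4, |E|/|(b,c)|=1/2), is claimed only for ε=1/(2[w]) and |E|≤|(b,c)|; the bound of w(E)/w(a,c) by the last term is still claimed for all E. *)

theory Defs
  imports "HOL-Analysis.Analysis"
begin

definition locally_integrable :: "(real \<Rightarrow> real) \<Rightarrow> bool" where
  "locally_integrable f \<longleftrightarrow> (\<forall>K. compact K \<longrightarrow> set_integrable lebesgue K f)"

definition maximal_minus :: "(real \<Rightarrow> real) \<Rightarrow> real \<Rightarrow> ennreal" where
  "maximal_minus f x =
     (SUP h\<in>{0<..}. (1 / ennreal h) * (\<integral>\<^sup>+t\<in>{x - h..x}. ennreal \<bar>f t\<bar> \<partial>lebesgue))"

definition weight :: "(real \<Rightarrow> real) \<Rightarrow> real set \<Rightarrow> ennreal" where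
  "weight w E = (\<integral>\<^sup>+t\<in>E. ennreal (w t) \<partial>lebesgue)"

text \<open>
  If \<open>w\<close> vanishes almost everywhere on \<open>(a, b)\<close>, the quotient below is \<open>0 / 0\<close>, which is \<open>0\<close>
  in \<^typ>\<open>ennreal\<close>, so such intervals do not contribute to the supremum.
\<close>

definition A_infty_plus_const :: "(real \<Rightarrow> real) \<Rightarrow> ennreal" where
  "A_infty_plus_const w =
     (SUP (a, b)\<in>{(a, b). a < b}.
        (\<integral>\<^sup>+x\<in>{a<..<b}. maximal_minus (\<lambda>t. w t * indicator {a<..<b} t) x \<partial>lebesgue)
        / weight w {a<..<b})"

definition A_infty_plus :: "(real \<Rightarrow> real) \<Rightarrow> bool" where
  "A_infty_plus w \<longleftrightarrow> A_infty_plus_const w < \<infinity>"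

text \<open>
  The left-hand integral is taken in \<^typ>\<open>ennreal\<close>, so that the inequality includes the
  local integrability of \<open>w\<close> to the power \<open>1 + \<epsilon>\<close>.  The right-hand integral is finite for
  locally integrable \<open>w\<close>; \<^const>\<open>enn2real\<close> is needed only because real powers are not available
  on \<^typ>\<open>ennreal\<close>.
\<close>

definition one_sided_reverse_Hoelder :: "(real \<Rightarrow> real) \<Rightarrow> real \<Rightarrow> bool" where
  "one_sided_reverse_Hoelder w \<epsilon> \<longleftrightarrow>
     (\<forall>a b c. a < b \<and> b < c \<longrightarrow>
        ennreal (measure lebesgue {b<..<c} powr \<epsilon>)
          * (\<integral>\<^sup>+t\<in>{a<..<b}. ennreal (w t powr (1 + \<epsilon>)) \<partial>lebesgue)
        \<le> 2 * ennreal (enn2real (weight w {a<..<c}) powr (1 + \<epsilon>)))"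

text \<open>
  The estimate of \<open>w(E) / w(a, c)\<close> by twice the \<open>\<delta>\<close>-th power of \<open>|E| / |(b, c)|\<close>.  As above,
  \<open>0 / 0\<close> is \<open>0\<close> if \<open>w\<close> vanishes almost everywhere on \<open>(a, c)\<close>.
\<close>

definition one_sided_weight_bound :: "(real \<Rightarrow> real) \<Rightarrow> real \<Rightarrow> bool" where
  "one_sided_weight_bound w \<delta> \<longleftrightarrow>
     (\<forall>a b c E. a < b \<and> b < c \<and> E \<in> sets lebesgue \<and> E \<subseteq> {a<..<b} \<longrightarrow>
        weight w E / weight w {a<..<c}
        \<le> ennreal (2 * (measure lebesgue E / measure lebesgue {b<..<c}) powr \<delta>))"

end

theory Submission
  imports Defs
begin

text \<open>
  The weight \<open>w\<close>, restricted to an interval, is a finite measure \<open>N\<close> without atoms.  The set where its backward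
  maximal function exceeds a level \<open>s\<close> is open, and by the rising sun lemma (\<open>rising_sun\<close>) \<open>N\<close> has average
  exactly \<open>s\<close> on each of its bounded components \<open>(p, q)\<close>.  Moreover, on \<open>(p, q)\<close> the maximal function only sees the mass
  in \<open>(p, q)\<close> (\<open>backward_max_localise\<close>).  So the \<open>A\<^sub>\<infinity>\<^sup>+\<close> condition, applied to each component, bounds the
  integral of the maximal function over a superlevel set of level \<open>s\<close> and measure \<open>u(s)\<close> by \<open>A s u(s)\<close>, where \<open>A\<close> is the \<open>A\<^sub>\<infinity>\<^sup>+\<close> constant.

  For (i), take \<open>N\<close> to be \<open>w\<close> on \<open>(a, c)\<close> and keep those components that begin to the left of \<open>b\<close>.  At levels
  \<open>s \<ge> l = w(a, c) / (c - b)\<close> they are shorter than the gap \<open>(b, c)\<close> and stay inside \<open>(a, c)\<close>.  On the other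
  hand the integral of the maximal function is at least \<open>s u(s) + \<integral>\<^sub>s\<^sup>\<infinity> u\<close>, so that
  \<open>\<integral>\<^sub>s\<^sup>\<infinity> u \<le> (A - 1) s u(s)\<close>.  Such a decay of the tails improves itself to a bound for
  \<open>\<integral> t\<^sup>\<epsilon> u(t) dt\<close> as long as \<open>\<epsilon> A \<le> 1/2\<close> (\<open>tail_bound_imp_powr_bound\<close>).  Since \<open>w\<close> is dominated by its
  maximal function almost everywhere, the layer cake formula turns this into the reverse Hoelder inequality
  (\<open>reverse_Hoelder_interval\<close>).  Part (ii) follows from (i) by Hoelder's inequality (\<open>weight_Hoelder\<close>), and
  the exponent \<open>1 / (3 A)\<close> is admissible because \<open>A \<ge> 1\<close>.

  For (iii) it is enough to start from the bound for \<open>w(E)\<close> in (ii), with exponent \<open>\<delta>\<close>.  On an interval \<open>(p, q)\<close>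
  followed by a gap \<open>(q, r)\<close> of comparable length it combines with the weak type inequality to give
  \<open>\<integral> M\<^sup>-(w 1\<^bsub>(p, q)\<^esub>) \<lesssim> w(p, r) / \<delta>\<close> (\<open>integral_backward_max_le_of_gap\<close>).  An interval \<open>(a, b)\<close>, which has
  no gap of its own, is divided into pieces that shrink geometrically towards \<open>b\<close>, each with the next piece as
  its gap; the mass that is far to the left of a piece enters through the kernel \<open>2 / (b - t)\<close>, whose total contribution is
  \<open>2 w(a, b)\<close> by Tonelli's theorem.  This gives the constant \<open>20 + 6 / \<delta>\<close>, which for \<open>\<delta> = \<epsilon> / 2\<close> is at most \<open>32 / \<epsilon>\<close>.
\<close>

section \<open>Superlevel sets of the backward maximal function\<close>

definition backward_max :: "real measure \<Rightarrow> real \<Rightarrow> ennreal" where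
  "backward_max N x = (SUP h\<in>{0<..}. (1 / ennreal h) * emeasure N {x - h..x})"

definition superlevel :: "real measure \<Rightarrow> real \<Rightarrow> real set" where
  "superlevel N s = {x. \<exists>y<x. s * (x - y) < measure N {y<..x}}"

lemma open_Union_intervals:
  fixes U :: "real set"
  assumes "open U" "bounded U"
  shows "\<exists>\<C>. countable \<C> \<and> disjoint_family_on (\<lambda>C. C) \<C> \<and> \<Union>\<C> = U \<and>
    (\<forall>C\<in>\<C>. \<exists>p q. p < q \<and> C = {p<..<q} \<and> p \<notin> U \<and> q \<notin> U)"
proof (rule exI[of _ "components U"], intro conjI ballI)
  let ?C = "components U"
  have op: "open C" "C \<noteq> {}" if "C \<in> ?C" for C
    using that assms(1) by (auto intro: open_components dest: in_components_nonempty)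
  show dis: "disjoint_family_on (\<lambda>C. C) ?C"
    using components_nonoverlap by (auto simp: disjoint_family_on_def)
  show "countable ?C"
    using op(1) pairwise_disjoint_components[of U]
    by (intro countable_disjoint_open_subsets) (auto simp: pairwise_def disjnt_def)
  show "\<Union>?C = U" by (simp add: Union_components)
  fix C assume C: "C \<in> ?C"
  then have sub: "C \<subseteq> U" and conn: "connected C" and ne: "C \<noteq> {}" and oC: "open C"
    by (auto simp: in_components_subset in_components_connected op)
  have bC: "bdd_above C" "bdd_below C"
    using bounded_subset[OF assms(2) sub] by (auto simp: bounded_imp_bdd_above bounded_imp_bdd_below)
  define p q where "p = Inf C" and "q = Sup C"
  have Csub: "C \<subseteq> {p<..<q}"
  proof
    fix x assume x: "x \<in> C"
    then obtain e where e: "e > 0" "ball x e \<subseteq> C" using oC openE by blast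
    then have "x - e/2 \<in> C" "x + e/2 \<in> C" by (auto simp: dist_real_def)
    then have "p \<le> x - e/2" "x + e/2 \<le> q"
      unfolding p_def q_def using bC by (auto intro: cInf_lower cSup_upper)
    then show "x \<in> {p<..<q}" using e by auto
  qed
  have "{p<..<q} \<subseteq> C"
  proof
    fix x assume x: "x \<in> {p<..<q}"
    then obtain y z where "y \<in> C" "y < x" "z \<in> C" "x < z"
      unfolding p_def q_def using ne bC by (auto simp: cInf_less_iff less_cSup_iff)
    then show "x \<in> C" using conn connected_contains_Icc[of C y z] by auto
  qed
  with Csub have Ceq: "C = {p<..<q}" by auto
  with ne have pq: "p < q" by auto
  have out: "z \<notin> U" if "z = p \<or> z = q" for z
  proof
    assume z: "z \<in> U"
    have "connected (insert z C)"
      by (rule connected_intermediate_closure[OF conn]) (use that pq in \<open>auto simp: Ceq\<close>)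
    then have "insert z C \<subseteq> C"
      using C z sub ne by (intro components_maximal[OF C]) auto
    then show False using that Ceq by auto
  qed
  show "\<exists>p q. p < q \<and> C = {p<..<q} \<and> p \<notin> U \<and> q \<notin> U"
    using pq Ceq out by blast
qed

text \<open>
  All estimates of the mass of an open set below are proved on one component interval at a time;
  countable additivity puts them together.
\<close>

lemma emeasure_le_by_components:
  fixes M N :: "real measure"
  assumes "countable \<C>" "disjoint_family_on (\<lambda>C. C) \<C>"
    and "\<And>C. C \<in> \<C> \<Longrightarrow> C \<in> sets M" "\<And>C. C \<in> \<C> \<Longrightarrow> C \<in> sets N"
    and "\<And>C. C \<in> \<C> \<Longrightarrow> emeasure M C \<le> emeasure N C"
  shows "emeasure M (\<Union>\<C>) \<le> emeasure N (\<Union>\<C>)"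
proof -
  have "emeasure M (\<Union>\<C>) = (\<integral>\<^sup>+C. emeasure M C \<partial>count_space \<C>)"
    using emeasure_UN_countable[of \<C> "\<lambda>C. C" M] assms by auto
  also have "\<dots> \<le> (\<integral>\<^sup>+C. emeasure N C \<partial>count_space \<C>)"
    by (rule nn_integral_mono) (use assms in auto)
  also have "\<dots> = emeasure N (\<Union>\<C>)"
    using emeasure_UN_countable[of \<C> "\<lambda>C. C" N] assms by auto
  finally show ?thesis .
qed

locale continuous_finite_measure = finite_measure N for N :: "real measure" +
  assumes sets_N: "sets N = sets lebesgue"
    and no_atoms: "emeasure N {x} = 0"
begin

lemma intervals_measurable [simp, measurable]:
  "{x<..y} \<in> sets N" "{x<..<y} \<in> sets N" "{x..y} \<in> sets N" "{..y} \<in> sets N" "{x} \<in> sets N"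
  by (auto simp: sets_N)

lemma measure_Ioc: "x \<le> y \<Longrightarrow> measure N {x<..y} = measure N {..y} - measure N {..x}"
proof -
  assume "x \<le> y"
  then have "{..y} = {..x} \<union> {x<..y}" by auto
  then have "measure N {..y} = measure N {..x} + measure N {x<..y}"
    by (simp only:, subst finite_measure_Union) auto
  then show ?thesis by simp
qed

lemma measure_Icc: "x \<le> y \<Longrightarrow> measure N {x..y} = measure N {x<..y}"
proof -
  assume "x \<le> y"
  then have "{x..y} = {x} \<union> {x<..y}" by auto
  then have "measure N {x..y} = measure N {x} + measure N {x<..y}"
    by (simp only:, subst finite_measure_Union) auto
  then show ?thesis using no_atoms by (simp add: measure_def)
qed

lemma measure_Ioo_eq: "x < y \<Longrightarrow> measure N {x<..<y} = measure N {x<..y}"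
proof -
  assume "x < y"
  then have "{x<..y} = {x<..<y} \<union> {y}" by auto
  then have "measure N {x<..y} = measure N {x<..<y} + measure N {y}"
    by (simp only:, subst finite_measure_Union) auto
  then show ?thesis by (simp add: no_atoms measure_def)
qed

lemma continuous_distribution: "continuous_on UNIV (\<lambda>x. measure N {..x})"
proof (clarsimp simp: continuous_on_eq_continuous_within isCont_def[symmetric])
  fix x
  show "isCont (\<lambda>x. measure N {..x}) x"
  proof (subst continuous_at_sequentially, clarsimp simp: comp_def)
    fix X :: "nat \<Rightarrow> real" assume X: "X \<longlonglongrightarrow> x"
    have "(\<lambda>n. \<integral>t. indicator {..X n} t \<partial>N) \<longlonglongrightarrow> (\<integral>t. indicator {..x} t \<partial>N :: real)"
    proof (rule integral_dominated_convergence[where w="\<lambda>_. 1"])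
      have "AE t in N. t \<noteq> x"
        by (rule AE_I[where N="{x}"]) (auto simp: no_atoms)
      then show "AE t in N. (\<lambda>n. indicator {..X n} t :: real) \<longlonglongrightarrow> indicator {..x} t"
      proof eventually_elim
        case (elim t)
        have "eventually (\<lambda>n. indicator {..X n} t = (indicator {..x} t :: real)) sequentially"
        proof (cases "t < x")
          case True
          then have "eventually (\<lambda>n. t < X n) sequentially" using X order_tendstoD by blast
          then show ?thesis by eventually_elim (use True in auto)
        next
          case False
          then have "eventually (\<lambda>n. X n < t) sequentially"
            using X elim order_tendstoD(2)[of X x _ t] by auto
          then show ?thesis by eventually_elim (use False elim in auto)
        qed
        then show ?case by (rule tendsto_eventually)
      qed
    qed (auto simp: indicator_def)
    then show "(\<lambda>n. measure N {..X n}) \<longlonglongrightarrow> measure N {..x}" by simp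
  qed
qed

lemma superlevel_iff:
  "x \<in> superlevel N s \<longleftrightarrow> (\<exists>y<x. measure N {..y} - s * y < measure N {..x} - s * x)"
  unfolding superlevel_def by (auto simp: measure_Ioc algebra_simps)

lemma continuous_tilted: "continuous_on A (\<lambda>x. measure N {..x} - s * x)"
  by (intro continuous_intros continuous_on_subset[OF continuous_distribution]) auto

lemma open_superlevel: "open (superlevel N s)"
proof -
  have "superlevel N s = (\<Union>y. {y<..} \<inter> {x. measure N {..y} - s * y < measure N {..x} - s * x})"
    by (auto simp: superlevel_iff)
  also have "open \<dots>"
    by (intro open_UN ballI open_Int open_Collect_less continuous_tilted continuous_on_const open_greaterThan)
  finally show ?thesis .
qed

lemma less_backward_max_iff:
  assumes "s \<ge> 0" shows "ennreal s < backward_max N x \<longleftrightarrow> x \<in> superlevel N s"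
proof -
  have *: "ennreal s < 1 / ennreal h * emeasure N {x - h..x} \<longleftrightarrow> s * h < measure N {x - h<..x}"
    if "h > 0" for h
  proof -
    have "1 / ennreal h * emeasure N {x - h..x} = ennreal (measure N {x - h<..x} / h)"
      using that by (simp add: measure_Icc emeasure_eq_measure divide_ennreal
          flip: ennreal_1 ennreal_mult)
    then show ?thesis using that assms by (simp add: ennreal_less_iff field_simps)
  qed
  show ?thesis
  proof
    assume "ennreal s < backward_max N x"
    then obtain h where h: "h > 0" "s * h < measure N {x - h<..x}"
      unfolding backward_max_def less_SUP_iff using * by auto
    then show "x \<in> superlevel N s" unfolding superlevel_def by (auto intro!: exI[of _ "x - h"])
  next
    assume "x \<in> superlevel N s"
    then obtain y where "y < x" "s * (x - y) < measure N {y<..x}" unfolding superlevel_def by auto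
    then show "ennreal s < backward_max N x"
      unfolding backward_max_def less_SUP_iff using *[of "x - y"] by (auto intro!: bexI[of _ "x - y"])
  qed
qed

lemma not_superlevelD: "\<lbrakk>x \<notin> superlevel N s; y \<le> x\<rbrakk> \<Longrightarrow> measure N {y<..x} \<le> s * (x - y)"
  unfolding superlevel_def by (cases "y = x") (auto simp: not_less dest: spec[of _ y])

text \<open>
  Put \<open>G x = N(-\<infinity>, x] - s x\<close>.  A point lies in the superlevel set iff \<open>G\<close> takes a smaller value
  somewhere to its left.  If \<open>G x < G p\<close>, look at a minimum point \<open>z\<close> of \<open>G\<close> on \<open>[p, x]\<close>: as \<open>z\<close> is in the
  superlevel set, \<open>G\<close> takes a still smaller value to the left of \<open>z\<close>, hence to the left of \<open>p\<close>, and then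
  \<open>p\<close> would be in the superlevel set as well.
\<close>

lemma rising_sun:
  assumes "{p<..<q} \<subseteq> superlevel N s" "p \<notin> superlevel N s" "x \<in> {p<..q}"
  shows "s * (x - p) \<le> measure N {p<..x}"
proof -
  let ?G = "\<lambda>x. measure N {..x} - s * x"
  have main: "?G p \<le> ?G x" if x: "x \<in> {p<..<q}" for x
  proof (rule ccontr)
    assume neg: "\<not> ?G p \<le> ?G x"
    obtain z where z: "z \<in> {p..x}" "\<And>y. y \<in> {p..x} \<Longrightarrow> ?G z \<le> ?G y"
      using continuous_attains_inf[OF compact_Icc _ continuous_tilted, of p x s] x by auto
    from z(2)[of x] neg x have lt: "?G z < ?G p" by auto
    with z(1) have "z \<in> {p<..<q}" using x by (cases "z = p") auto
    then obtain y where y: "y < z" "?G y < ?G z" using assms(1) superlevel_iff by blast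
    have "\<not> p \<le> y" using z y by (meson atLeastAtMost_iff leD less_le_trans less_imp_le order_trans)
    then have "p \<in> superlevel N s" using y lt unfolding superlevel_iff by (intro exI[of _ y]) auto
    with assms(2) show False by simp
  qed
  have "?G p \<le> ?G x"
  proof (cases "x = q")
    case True
    have "(?G \<longlongrightarrow> ?G q) (at_left q)"
      using continuous_tilted[of UNIV s] by (auto simp: continuous_on_eq_continuous_within continuous_within
          intro: tendsto_within_subset)
    moreover have "eventually (\<lambda>x. ?G p \<le> ?G x) (at_left q)"
      using assms(3) True by (intro eventually_at_leftI[of p] main) auto
    ultimately show ?thesis unfolding True
      by (intro tendsto_lowerbound[where f="?G"]) auto
  qed (use main assms(3) in auto)
  then show ?thesis using assms(3) by (auto simp: measure_Ioc algebra_simps)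
qed

text \<open>
  On a component whose right end is also outside the superlevel set the average of \<open>N\<close> is therefore exactly
  the level.
\<close>

lemma rising_sun_eq:
  assumes "{p<..<q} \<subseteq> superlevel N s" "p \<notin> superlevel N s" "q \<notin> superlevel N s" "p < q"
  shows "measure N {p<..<q} = s * (q - p)"
  using rising_sun[OF assms(1,2), of q] not_superlevelD[OF assms(3), of p] assms(4)
  by (simp add: measure_Ioo_eq)

text \<open>
  For \<open>x\<close> in a component \<open>(p, q)\<close>, an interval \<open>[x - h, x]\<close> that sticks out to the left of \<open>p\<close> may be cut off at
  \<open>p\<close>: the part that is removed has average at most \<open>s\<close>, as \<open>p\<close> is outside the superlevel set, and the part that
  is kept has average at least \<open>s\<close>, by \<open>rising_sun\<close>.  This is what makes the \<open>A\<^sub>\<infinity>\<^sup>+\<close> condition applicable on every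
  component separately.
\<close>

lemma backward_max_localise:
  assumes "{p<..<q} \<subseteq> superlevel N s" "p \<notin> superlevel N s" "x \<in> {p<..<q}"
  shows "backward_max N x \<le> (SUP h\<in>{0<..}. (1 / ennreal h) * emeasure N ({x - h..x} \<inter> {p<..<q}))"
  unfolding backward_max_def
proof (rule SUP_mono)
  fix h :: real assume "h \<in> {0<..}" then have h: "h > 0" by simp
  show "\<exists>k\<in>{0<..}. 1 / ennreal h * emeasure N {x - h..x} \<le>
          1 / ennreal k * emeasure N ({x - k..x} \<inter> {p<..<q})"
  proof (cases "p < x - h")
    case True
    then have "{x - h..x} \<inter> {p<..<q} = {x - h..x}" using assms(3) by auto
    then show ?thesis using h by (intro bexI[of _ h]) auto
  next
    case False
    define k where "k = x - p"
    have k: "0 < k" "k \<le> h" using False assms(3) by (auto simp: k_def)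
    have N1: "measure N {x - h<..p} \<le> s * (p - (x - h))"
      using not_superlevelD[OF assms(2)] False by auto
    have N2: "s * k \<le> measure N {p<..x}" unfolding k_def using rising_sun[OF assms(1,2), of x] assms(3) by auto
    have "measure N {x - h<..x} = measure N {x - h<..p} + measure N {p<..x}"
      using k by (simp add: measure_Ioc k_def)
    also have "\<dots> \<le> s * (h - k) + measure N {p<..x}" using N1 by (simp add: k_def algebra_simps)
    finally have "k * measure N {x - h<..x} \<le> k * (s * (h - k)) + k * measure N {p<..x}"
      using k by (metis distrib_left less_imp_le mult_left_mono)
    also have "\<dots> = (s * k) * (h - k) + k * measure N {p<..x}" by simp
    also have "\<dots> \<le> measure N {p<..x} * (h - k) + k * measure N {p<..x}"
      using N2 k by (intro add_mono mult_right_mono) auto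
    finally have "k * measure N {x - h<..x} \<le> h * measure N {p<..x}" by (simp add: algebra_simps)
    then have le: "measure N {x - h<..x} / h \<le> measure N {p<..x} / k"
      using k h by (simp add: field_simps)
    have "{x - k..x} \<inter> {p<..<q} = {p<..x}" using assms(3) by (auto simp: k_def)
    moreover have "1 / ennreal h * emeasure N {x - h..x} \<le> 1 / ennreal k * emeasure N {p<..x}"
      using k h le by (simp add: measure_Icc emeasure_eq_measure divide_ennreal flip: ennreal_1 ennreal_mult)
    ultimately show ?thesis using k by (intro bexI[of _ k]) auto
  qed
qed

lemma superlevel_mono: "s \<le> t \<Longrightarrow> superlevel N t \<subseteq> superlevel N s"
proof (clarsimp simp: superlevel_def)
  fix x y assume "s \<le> t" "y < x" "t * (x - y) < measure N {y<..x}"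
  moreover from this have "s * (x - y) \<le> t * (x - y)" by (intro mult_right_mono) auto
  ultimately have "y < x" "s * (x - y) < measure N {y<..x}" by linarith+
  then show "\<exists>y<x. s * (x - y) < measure N {y<..x}" by (intro exI[of _ y]) auto
qed

lemma superlevel_Union: "superlevel N s = (\<Union>t\<in>{s<..}. superlevel N t)"
proof
  show "superlevel N s \<subseteq> (\<Union>t\<in>{s<..}. superlevel N t)"
  proof
    fix x assume "x \<in> superlevel N s"
    then obtain y where y: "y < x" "s * (x - y) < measure N {y<..x}" unfolding superlevel_def by auto
    then have "s < measure N {y<..x} / (x - y)" by (simp add: field_simps)
    then obtain t where t: "s < t" "t < measure N {y<..x} / (x - y)" using dense by blast
    then have "t * (x - y) < measure N {y<..x}" using y by (simp add: field_simps)
    then show "x \<in> (\<Union>t\<in>{s<..}. superlevel N t)" using y t by (auto simp: superlevel_def)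
  qed
next
  show "(\<Union>t\<in>{s<..}. superlevel N t) \<subseteq> superlevel N s"
    by (intro UN_least superlevel_mono) auto
qed

text \<open>
  This plays the part of Lebesgue's differentiation theorem.  Cover \<open>E\<close> by an open set of almost the same
  measure.  In a component \<open>(p, q)\<close> of it let \<open>t\<close> be the supremum of \<open>E\<close>; the superlevel set is open, so \<open>t\<close> is
  outside it, and \<open>N(p, t] \<le> s (t - p)\<close>, which bounds the mass of \<open>E \<inter> (p, q)\<close> by \<open>s (q - p)\<close>.
\<close>

lemma emeasure_off_superlevel:
  assumes E: "E \<in> sets lebesgue" "bounded E" "E \<inter> superlevel N s = {}" and s: "s \<ge> 0"
  shows "emeasure N E \<le> ennreal s * emeasure lebesgue E"
proof -
  obtain R where R: "E \<subseteq> {-R<..<R}"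
    using bounded_subset_box_symmetric[OF E(2)] by (auto simp: box_real)
  have fin: "emeasure lebesgue E < \<infinity>"
    using bounded_set_imp_lmeasurable[OF E(2,1)] by (auto simp: fmeasurable_def)
  have *: "emeasure N E \<le> ennreal s * (emeasure lebesgue E + ennreal e)" if "e > 0" for e
  proof -
    obtain T where T: "open T" "E \<subseteq> T" "T - E \<in> lmeasurable" "emeasure lebesgue (T - E) < ennreal e"
      using sets_lebesgue_outer_open[OF E(1) \<open>e > 0\<close>] .
    let ?V = "T \<inter> {-R<..<R}"
    have "open ?V" "bounded ?V" using T by (auto intro: bounded_subset[OF bounded_Ioo])
    then obtain \<C> where \<C>: "countable \<C>" "disjoint_family_on (\<lambda>C. C) \<C>" "\<Union>\<C> = ?V"
      "\<And>C. C \<in> \<C> \<Longrightarrow> \<exists>p q. p < q \<and> C = {p<..<q} \<and> p \<notin> ?V \<and> q \<notin> ?V"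
      using open_Union_intervals[of ?V] by meson
    have "emeasure (density N (indicator E)) (\<Union>\<C>) \<le> emeasure (scale_measure (ennreal s) lebesgue) (\<Union>\<C>)"
    proof (rule emeasure_le_by_components[OF \<C>(1,2)])
      fix C assume "C \<in> \<C>"
      then obtain p q where C: "C = {p<..<q}" "p < q" using \<C>(4) by blast
      show "C \<in> sets (density N (indicator E))" "C \<in> sets (scale_measure (ennreal s) lebesgue)"
        by (auto simp: C)
      have "emeasure N (E \<inter> C) \<le> ennreal (s * (q - p))"
      proof (cases "E \<inter> C = {}")
        case False
        define t where "t = Sup (E \<inter> C)"
        have bdd: "bdd_above (E \<inter> C)" unfolding C by (intro bdd_aboveI[of _ q]) auto
        have "t \<in> - superlevel N s"
          unfolding t_def
        proof (rule closed_subset_contains_Sup[OF _ _ False bdd])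
          show "closed (- superlevel N s)" using open_superlevel by (simp add: closed_def)
        qed (use E(3) in auto)
        then have t: "t \<notin> superlevel N s" by simp
        from False obtain z where "z \<in> E" "z \<in> C" by auto
        then have "z \<le> t" unfolding t_def using bdd by (intro cSup_upper) auto
        with \<open>z \<in> C\<close> have "p < t" by (simp add: C)
        have "t \<le> q" unfolding t_def using False by (intro cSup_least) (auto simp: C)
        have "E \<inter> C \<subseteq> {p<..t}"
          using cSup_upper[OF _ bdd] by (auto simp: C t_def)
        then have "emeasure N (E \<inter> C) \<le> emeasure N {p<..t}"
          by (intro emeasure_mono) auto
        also have "\<dots> \<le> ennreal (s * (t - p))"
          using not_superlevelD[OF t, of p] \<open>p < t\<close> s by (auto simp: emeasure_eq_measure intro: ennreal_leI)
        also have "\<dots> \<le> ennreal (s * (q - p))"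
          using \<open>t \<le> q\<close> s by (intro ennreal_leI mult_left_mono) auto
        finally show ?thesis .
      qed simp
      then show "emeasure (density N (indicator E)) C \<le> emeasure (scale_measure (ennreal s) lebesgue) C"
        using E(1) C s by (simp add: emeasure_restricted sets_N ennreal_mult)
    qed
    moreover have "emeasure (density N (indicator E)) (\<Union>\<C>) = emeasure N E"
    proof -
      have "?V \<in> sets N" using T(1) by (auto simp: sets_N)
      then show ?thesis using E(1) T(2) R by (simp add: \<C>(3) emeasure_restricted sets_N) (metis Int_absorb2 Int_greatest)
    qed
    moreover have "emeasure lebesgue (\<Union>\<C>) \<le> emeasure lebesgue E + ennreal e"
    proof -
      have "emeasure lebesgue (\<Union>\<C>) \<le> emeasure lebesgue (E \<union> (T - E))"
        using E(1) T(1) by (intro emeasure_mono) (auto simp: \<C>(3))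
      also have "\<dots> \<le> emeasure lebesgue E + emeasure lebesgue (T - E)"
        using E(1) T(1) by (intro emeasure_subadditive) auto
      also have "\<dots> \<le> emeasure lebesgue E + ennreal e" using T(4) by (intro add_left_mono) auto
      finally show ?thesis .
    qed
    ultimately show ?thesis by (auto elim!: order_trans intro: mult_left_mono)
  qed
  obtain r where r: "emeasure lebesgue E = ennreal r" "r \<ge> 0" using fin by (cases "emeasure lebesgue E") auto
  have eps: "emeasure N E \<le> ennreal (s * r + e)" if "e > 0" for e
  proof (cases "s = 0")
    case True then show ?thesis using *[of 1] by simp
  next
    case False
    then show ?thesis using *[of "e / s"] s r that by (simp add: distrib_left flip: ennreal_plus ennreal_mult)
  qed
  have "emeasure N E \<le> ennreal (s * r)"
  proof (rule ennreal_le_epsilon)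
    fix e :: real assume "0 < e"
    with eps[of e] show "emeasure N E \<le> ennreal (s * r) + ennreal e" using s r by simp
  qed
  then show ?thesis using s r by (simp add: ennreal_mult)
qed

lemma backward_max_measurable [measurable]: "backward_max N \<in> borel_measurable lebesgue"
proof (rule borel_measurableI_greater)
  fix y :: ennreal
  show "{x \<in> space lebesgue. y < backward_max N x} \<in> sets lebesgue"
  proof (cases y)
    case (real r)
    then have "{x \<in> space lebesgue. y < backward_max N x} = superlevel N r"
      using less_backward_max_iff by auto
    then show ?thesis using open_superlevel[of r] by simp
  qed simp
qed

end

text \<open>
  The union of those components of the superlevel set that meet \<open>(-\<infinity>, b)\<close>.  Intersecting the superlevel set
  with \<open>(-\<infinity>, b)\<close> instead would cut the component that contains \<open>b\<close>, and lose the equality of its average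
  and the level.
\<close>

definition left_superlevel :: "real measure \<Rightarrow> real \<Rightarrow> real \<Rightarrow> real set" where
  "left_superlevel N b s = {x. \<exists>p<b. p \<le> x \<and> {p..x} \<subseteq> superlevel N s}"

context continuous_finite_measure begin

lemma left_superlevel_subset: "left_superlevel N b s \<subseteq> superlevel N s"
proof
  fix x assume "x \<in> left_superlevel N b s"
  then obtain p where "p \<le> x" "{p..x} \<subseteq> superlevel N s" unfolding left_superlevel_def by blast
  then show "x \<in> superlevel N s" by (meson atLeastAtMost_iff order_refl subsetD)
qed

lemma superlevel_subset_left_superlevel: "superlevel N s \<inter> {..<b} \<subseteq> left_superlevel N b s"
proof
  fix x assume "x \<in> superlevel N s \<inter> {..<b}"
  then show "x \<in> left_superlevel N b s"
    unfolding left_superlevel_def by (auto intro!: exI[of _ x])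
qed

lemma left_superlevel_mono: "s \<le> t \<Longrightarrow> left_superlevel N b t \<subseteq> left_superlevel N b s"
proof
  fix x assume "s \<le> t" "x \<in> left_superlevel N b t"
  then obtain p where "p < b" "p \<le> x" "{p..x} \<subseteq> superlevel N t" unfolding left_superlevel_def by blast
  with superlevel_mono[OF \<open>s \<le> t\<close>] show "x \<in> left_superlevel N b s"
    unfolding left_superlevel_def by (intro CollectI exI[of _ p]) auto
qed

text \<open>
  The interval \<open>[p, x]\<close> is compact and the superlevel sets are open, so one higher level suffices for all of
  \<open>[p, x]\<close>.
\<close>

lemma left_superlevel_Union: "left_superlevel N b s = (\<Union>t\<in>{s<..}. left_superlevel N b t)"
proof
  show "left_superlevel N b s \<subseteq> (\<Union>t\<in>{s<..}. left_superlevel N b t)"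
  proof
    fix x assume "x \<in> left_superlevel N b s"
    then obtain p where p: "p < b" "p \<le> x" "{p..x} \<subseteq> superlevel N s" unfolding left_superlevel_def by auto
    then have "{p..x} \<subseteq> (\<Union>t\<in>{s<..}. superlevel N t)" using superlevel_Union[of s] by simp
    then obtain D where D: "D \<subseteq> {s<..}" "finite D" "{p..x} \<subseteq> (\<Union>t\<in>D. superlevel N t)"
      using compactE_image[OF compact_Icc] open_superlevel by metis
    have ne: "D \<noteq> {}" using D(3) p(2) by force
    have "{p..x} \<subseteq> superlevel N (Min D)"
    proof
      fix y assume "y \<in> {p..x}"
      then obtain t where "t \<in> D" "y \<in> superlevel N t" using D by auto
      then show "y \<in> superlevel N (Min D)" using superlevel_mono[of "Min D" t] D by auto
    qed
    then have "x \<in> left_superlevel N b (Min D)" unfolding left_superlevel_def using p by auto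
    then show "x \<in> (\<Union>t\<in>{s<..}. left_superlevel N b t)" using D ne Min_in[of D] by (intro UN_I[of "Min D"]) auto
  qed
  show "(\<Union>t\<in>{s<..}. left_superlevel N b t) \<subseteq> left_superlevel N b s"
    by (intro UN_least left_superlevel_mono) auto
qed

lemma open_left_superlevel: "open (left_superlevel N b s)"
proof (rule openI)
  fix x assume "x \<in> left_superlevel N b s"
  then obtain p where p: "p < b" "p \<le> x" "{p..x} \<subseteq> superlevel N s" unfolding left_superlevel_def by auto
  then have "x \<in> superlevel N s" by auto
  then obtain e where e: "e > 0" "ball x e \<subseteq> superlevel N s" using open_superlevel openE by blast
  have "y \<in> left_superlevel N b s" if y: "y \<in> ball x e" for y
  proof (cases "p \<le> y")
    case True
    have "{p..y} \<subseteq> {p..x} \<union> ball x e" using y by (auto simp: dist_real_def)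
    then show ?thesis unfolding left_superlevel_def using p e True by auto
  next
    case False
    then have "{y..y} \<subseteq> superlevel N s" using y e by auto
    then show ?thesis unfolding left_superlevel_def using p False by (auto intro!: exI[of _ y])
  qed
  then show "\<exists>e>0. ball x e \<subseteq> left_superlevel N b s"
    using e(1) by (intro exI[of _ e]) auto
qed

text \<open>
  This is where the gap \<open>(b, c)\<close> is used: at the levels considered a component has length at most
  \<open>N(\<real>) / s \<le> c - b\<close>, so a component that starts before \<open>b\<close> ends before \<open>c\<close>.
\<close>

lemma left_superlevel_components:
  assumes "a < b" "b < c" and s: "s > 0" and supp: "measure N {..a} = 0" "measure N {c<..} = 0"
    and small: "measure N UNIV \<le> s * (c - b)"
  obtains \<C> where "countable \<C>" "disjoint_family_on (\<lambda>C. C) \<C>" "\<Union>\<C> = left_superlevel N b s"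
    "\<And>C. C \<in> \<C> \<Longrightarrow> \<exists>p q. p < q \<and> C = {p<..<q} \<and> C \<subseteq> superlevel N s \<and> p \<notin> superlevel N s \<and> q \<notin> superlevel N s
        \<and> a \<le> p \<and> q \<le> c"
proof -
  have sp: "space N = UNIV" using sets_eq_imp_space_eq[OF sets_N] by simp
  have le_UNIV: "measure N S \<le> measure N UNIV" if "S \<in> sets N" for S
    using bounded_measure[of S] sp by simp
  have low: "x > a" if x: "x \<in> superlevel N s" for x
  proof (rule ccontr)
    assume neg: "\<not> x > a"
    obtain y where y: "y < x" "s * (x - y) < measure N {y<..x}" using x unfolding superlevel_def by auto
    have "measure N {y<..x} \<le> measure N {..a}" using neg by (intro finite_measure_mono) auto
    moreover have "0 \<le> s * (x - y)" using y s by simp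
    ultimately show False using y supp by simp
  qed
  have high: "x < c + (c - b)" if x: "x \<in> superlevel N s" for x
  proof -
    obtain y where y: "y < x" "s * (x - y) < measure N {y<..x}" using x unfolding superlevel_def by auto
    have "y < c"
    proof (rule ccontr)
      assume "\<not> y < c"
      then have "measure N {y<..x} \<le> measure N {c<..}" by (intro finite_measure_mono) (auto simp: sets_N)
      moreover have "0 \<le> s * (x - y)" using y s by simp
    ultimately show False using y supp by simp
    qed
    have "s * (x - y) < s * (c - b)" using y le_UNIV[of "{y<..x}"] small by auto
    then show ?thesis using \<open>y < c\<close> s by (simp add: mult_less_cancel_left_pos)
  qed
  have "bounded (left_superlevel N b s)"
    using left_superlevel_subset low high
    by (intro bounded_subset[OF bounded_closed_interval[of a "c + (c - b)"]]) fastforce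
  then obtain \<C> where \<C>: "countable \<C>" "disjoint_family_on (\<lambda>C. C) \<C>" "\<Union>\<C> = left_superlevel N b s"
      "\<And>C. C \<in> \<C> \<Longrightarrow> \<exists>p q. p < q \<and> C = {p<..<q} \<and> p \<notin> left_superlevel N b s \<and> q \<notin> left_superlevel N b s"
    using open_Union_intervals[OF open_left_superlevel] by meson
  show ?thesis
  proof (rule that[OF \<C>(1-3)])
    fix C assume "C \<in> \<C>"
    then obtain p q where C: "p < q" "C = {p<..<q}" "p \<notin> left_superlevel N b s" "q \<notin> left_superlevel N b s"
      and CL: "C \<subseteq> left_superlevel N b s"
      using \<C>(3,4) by blast
    have CS: "C \<subseteq> superlevel N s" using CL left_superlevel_subset by auto
    obtain x where x: "x \<in> C" using C dense[of p q] by auto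
    then obtain r where r: "r < b" "r \<le> x" "{r..x} \<subseteq> superlevel N s"
      using CL unfolding left_superlevel_def by auto
    have "q \<notin> superlevel N s"
    proof
      assume "q \<in> superlevel N s"
      moreover have "{r..q} \<subseteq> {r..x} \<union> C \<union> {q}" using x C by auto
      ultimately have "{r..q} \<subseteq> superlevel N s" using r(3) CS by blast
      then have "q \<in> left_superlevel N b s" unfolding left_superlevel_def using r x C by auto
      with C show False by simp
    qed
    have p_out: "p \<notin> superlevel N s" "p < b"
    proof -
      have "\<not> r \<le> p"
      proof
        assume "r \<le> p"
        then have "{r..p} \<subseteq> superlevel N s" using r x C by auto
        then have "p \<in> left_superlevel N b s" unfolding left_superlevel_def using r \<open>r \<le> p\<close> by auto
        with C show False by simp
      qed
      then show "p < b" using r by simp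
      then show "p \<notin> superlevel N s" using superlevel_subset_left_superlevel C by auto
    qed
    have "a \<le> p"
    proof (rule ccontr)
      assume "\<not> a \<le> p"
      then obtain y where "p < y" "y < min a q" using C dense[of p "min a q"] by auto
      then show False using low[of y] CS C by auto
    qed
    have "s * (q - p) = measure N {p<..<q}"
      using rising_sun_eq[of p q s] CS p_out \<open>q \<notin> superlevel N s\<close> C by simp
    also have "\<dots> \<le> s * (c - b)" using le_UNIV[of "{p<..<q}"] small by auto
    finally have "q \<le> c" using s p_out by (simp add: mult_le_cancel_left_pos)
    then show "\<exists>p q. p < q \<and> C = {p<..<q} \<and> C \<subseteq> superlevel N s \<and> p \<notin> superlevel N s \<and> q \<notin> superlevel N s
        \<and> a \<le> p \<and> q \<le> c"
      using C CS p_out \<open>q \<notin> superlevel N s\<close> \<open>a \<le> p\<close> by blast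
  qed
qed

text \<open>
  The component that is cut off at \<open>b\<close> causes no harm: \<open>rising_sun\<close> bounds the average from below at every
  point of a component.
\<close>

lemma weak_type_superlevel:
  assumes s: "s \<ge> 0" and supp: "measure N {..a} = 0"
  shows "ennreal s * emeasure lebesgue (superlevel N s \<inter> {a<..<b}) \<le> emeasure N (superlevel N s \<inter> {a<..<b})"
proof -
  let ?U = "superlevel N s \<inter> {a<..<b}"
  have "open ?U" "bounded ?U" using open_superlevel by (auto intro: bounded_subset[OF bounded_Ioo])
  then obtain \<C> where \<C>: "countable \<C>" "disjoint_family_on (\<lambda>C. C) \<C>" "\<Union>\<C> = ?U"
      "\<And>C. C \<in> \<C> \<Longrightarrow> \<exists>p q. p < q \<and> C = {p<..<q} \<and> p \<notin> ?U \<and> q \<notin> ?U"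
    using open_Union_intervals[of ?U] by meson
  have a: "a \<notin> superlevel N s"
  proof
    assume "a \<in> superlevel N s"
    then obtain y where y: "y < a" "s * (a - y) < measure N {y<..a}" unfolding superlevel_def by auto
    have "measure N {y<..a} \<le> measure N {..a}" by (intro finite_measure_mono) auto
    moreover have "0 \<le> s * (a - y)" using y s by simp
    ultimately show False using y supp by simp
  qed
  have "emeasure (scale_measure (ennreal s) lebesgue) (\<Union>\<C>) \<le> emeasure N (\<Union>\<C>)"
  proof (rule emeasure_le_by_components[OF \<C>(1,2)])
    fix C assume "C \<in> \<C>"
    then obtain p q where C: "p < q" "C = {p<..<q}" "p \<notin> ?U" "C \<subseteq> ?U" using \<C>(3,4) by blast
    show "C \<in> sets (scale_measure (ennreal s) lebesgue)" "C \<in> sets N" by (auto simp: C)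
    have "{p<..<q} \<subseteq> {a<..<b}" using C by auto
    then have "a \<le> p" "q \<le> b" using C(1) by (auto simp: greaterThanLessThan_subseteq_greaterThanLessThan)
    then have "p \<notin> superlevel N s" using C a by (cases "p = a") auto
    then have "s * (q - p) \<le> measure N {p<..q}" using C by (intro rising_sun) auto
    then show "emeasure (scale_measure (ennreal s) lebesgue) C \<le> emeasure N C"
      using C s by (simp add: emeasure_eq_measure measure_Ioo_eq flip: ennreal_mult)
  qed
  then show ?thesis using \<C>(3) by simp
qed

end

section \<open>Weights and the one-sided A-infinity condition\<close>

definition restricted_weight :: "(real \<Rightarrow> real) \<Rightarrow> real set \<Rightarrow> real measure" where
  "restricted_weight w I = density lebesgue (\<lambda>t. ennreal (w t * indicator I t))"

locale weight_function =
  fixes w :: "real \<Rightarrow> real"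
  assumes nonneg: "0 \<le> w x" and locint: "locally_integrable w"
begin

lemma w_measurable [measurable]: "w \<in> borel_measurable lebesgue"
proof (rule borel_measurable_LIMSEQ_real)
  fix n :: nat
  have "set_integrable lebesgue {- real n..real n} w" using locint by (auto simp: locally_integrable_def)
  then show "(\<lambda>x. indicator {- real n..real n} x * w x) \<in> borel_measurable lebesgue"
    unfolding set_integrable_def by auto
next
  fix x
  obtain k where "\<bar>x\<bar> \<le> real k" using real_arch_simple by blast
  then have "indicator {- real n..real n} x * w x = w x" if "n \<ge> k" for n
    using that by (auto simp: indicator_def abs_le_iff)
  then show "(\<lambda>n. indicator {- real n..real n} x * w x) \<longlonglongrightarrow> w x"
    by (intro tendsto_eventually eventually_sequentiallyI[of k]) auto
qed

lemma restricted_density_measurable: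
  assumes "I \<in> sets lebesgue"
  shows "(\<lambda>t. ennreal (w t * indicator I t)) \<in> borel_measurable lebesgue"
  using assms by (intro measurable_compose[OF borel_measurable_times[OF w_measurable borel_measurable_indicator]
     measurable_ennreal])

lemma emeasure_density_weight:
  assumes "E \<in> sets lebesgue"
  shows "emeasure (density lebesgue (\<lambda>t. ennreal (w t))) E = weight w E"
  unfolding weight_def
  by (rule emeasure_density[OF measurable_compose[OF w_measurable measurable_ennreal] assms])

lemma weight_mono: "E \<subseteq> F \<Longrightarrow> weight w E \<le> weight w F"
  unfolding weight_def by (intro nn_integral_mono) (auto split: split_indicator)

lemma weight_finite: "bounded E \<Longrightarrow> weight w E < \<infinity>"
proof -
  assume "bounded E"
  then obtain R where R: "E \<subseteq> {-R..R}"
    using bounded_subset_cbox_symmetric by (metis box_real(2))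
  have "set_integrable lebesgue {-R..R} w" using locint by (auto simp: locally_integrable_def)
  then have "(\<integral>\<^sup>+x. ennreal (norm (indicator {-R..R} x * w x)) \<partial>lebesgue) < \<infinity>"
    unfolding set_integrable_def integrable_iff_bounded by auto
  moreover have "weight w {-R..R} = (\<integral>\<^sup>+x. ennreal (norm (indicator {-R..R} x * w x)) \<partial>lebesgue)"
    unfolding weight_def using nonneg by (intro nn_integral_cong) (auto split: split_indicator)
  ultimately show ?thesis using weight_mono[OF R] by simp
qed

lemma emeasure_restricted_weight:
  assumes "I \<in> sets lebesgue" "E \<in> sets lebesgue"
  shows "emeasure (restricted_weight w I) E = weight w (E \<inter> I)"
  unfolding restricted_weight_def weight_def
  by (subst emeasure_density[OF restricted_density_measurable[OF assms(1)] assms(2)])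
     (auto intro!: nn_integral_cong split: split_indicator)

lemma sets_restricted_weight [simp]: "sets (restricted_weight w I) = sets lebesgue"
  by (simp add: restricted_weight_def)

lemma continuous_restricted_weight: "continuous_finite_measure (restricted_weight w {a<..<b})"
proof -
  let ?N = "restricted_weight w {a<..<b}"
  have "finite_measure ?N"
  proof (rule finite_measureI)
    have "space ?N = UNIV" by (simp add: restricted_weight_def)
    then show "emeasure ?N (space ?N) \<noteq> \<infinity>"
      using weight_finite[of "{a<..<b}"] by (simp add: emeasure_restricted_weight)
  qed
  moreover have "emeasure ?N {x} = 0" for x
  proof -
    have "absolutely_continuous lebesgue ?N"
      unfolding restricted_weight_def by (intro absolutely_continuousI_density restricted_density_measurable) auto
    then show ?thesis unfolding absolutely_continuous_def
      by (metis null_setsD1 subsetD null_sets_completionI[of "{x}" lborel] null_setsI[of lborel "{x}"]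
          emeasure_lborel_singleton sets_lborel borel_singleton sets.empty_sets)
  qed
  ultimately show ?thesis
    by (simp add: continuous_finite_measure_def continuous_finite_measure_axioms_def)
qed

lemma maximal_minus_eq:
  assumes "I \<in> sets lebesgue"
  shows "maximal_minus (\<lambda>t. w t * indicator I t) x = backward_max (restricted_weight w I) x"
  unfolding maximal_minus_def backward_max_def using assms
proof (intro SUP_cong refl arg_cong2[where f="(*)"])
  fix h
  show "(\<integral>\<^sup>+t\<in>{x - h..x}. ennreal \<bar>w t * indicator I t\<bar> \<partial>lebesgue) = emeasure (restricted_weight w I) {x - h..x}"
    using assms nonneg
    by (simp add: emeasure_restricted_weight weight_def)
       (auto intro!: nn_integral_cong split: split_indicator)
qed

lemma A_infty_plus_bound:
  assumes "A_infty_plus w" "a < b"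
  shows "(\<integral>\<^sup>+x\<in>{a<..<b}. backward_max (restricted_weight w {a<..<b}) x \<partial>lebesgue)
     \<le> A_infty_plus_const w * weight w {a<..<b}"
proof -
  let ?X = "\<integral>\<^sup>+x\<in>{a<..<b}. backward_max (restricted_weight w {a<..<b}) x \<partial>lebesgue"
  let ?W = "weight w {a<..<b}"
  have le: "?X / ?W \<le> A_infty_plus_const w"
    unfolding A_infty_plus_const_def
    using assms(2) by (intro SUP_upper2[of "(a, b)"]) (auto simp: maximal_minus_eq)
  have "?W \<noteq> \<infinity>" using weight_finite[of "{a<..<b}"] by simp
  show ?thesis
  proof (cases "?W = 0")
    case True
    have "?X = 0"
    proof (rule ccontr)
      assume "?X \<noteq> 0"
      then have "?X / ?W = \<infinity>" using True by (simp add: ennreal_divide_zero)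
      then show False using le assms(1) by (simp add: A_infty_plus_def top_unique)
    qed
    then show ?thesis by simp
  next
    case False
    have "?X = ?X / ?W * ?W"
      using False \<open>?W \<noteq> \<infinity>\<close> by (simp add: ennreal_divide_times less_top)
    also have "\<dots> \<le> A_infty_plus_const w * ?W" using le by (intro mult_right_mono) auto
    finally show ?thesis .
  qed
qed

text \<open>
  On this set \<open>E\<close> the weight exceeds \<open>s\<close>, yet \<open>w(E) \<le> s |E|\<close> by \<open>emeasure_off_superlevel\<close>.
\<close>

lemma null_off_superlevel:
  assumes "s \<ge> 0"
  shows "{x\<in>{a<..<b}. s < w x} - superlevel (restricted_weight w {a<..<b}) s \<in> null_sets lebesgue"
proof -
  interpret N: continuous_finite_measure "restricted_weight w {a<..<b}" by (rule continuous_restricted_weight)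
  let ?N = "restricted_weight w {a<..<b}"
  define E where "E = {x\<in>{a<..<b}. s < w x} - superlevel ?N s"
  have [measurable]: "superlevel ?N s \<in> sets lebesgue" using N.open_superlevel by simp
  have "{x \<in> space lebesgue. s < w x} \<in> sets lebesgue" by measurable
  then have "{x \<in> space lebesgue. s < w x} \<inter> {a<..<b} - superlevel ?N s \<in> sets lebesgue"
    by (intro sets.Diff sets.Int) auto
  also have "{x \<in> space lebesgue. s < w x} \<inter> {a<..<b} - superlevel ?N s = E"
    by (auto simp: E_def)
  finally have E[measurable]: "E \<in> sets lebesgue" .
  have bE: "bounded E" by (rule bounded_subset[OF bounded_Ioo[of a b]]) (auto simp: E_def)
  have fin: "emeasure lebesgue E < \<infinity>"
    using bounded_set_imp_lmeasurable[OF bE E] by (auto simp: fmeasurable_def)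
  have wE: "weight w E \<le> ennreal s * emeasure lebesgue E"
  proof -
    have "weight w E = emeasure ?N E"
    proof -
      have "E \<inter> {a<..<b} = E" by (auto simp: E_def)
      then show ?thesis using emeasure_restricted_weight[of "{a<..<b}" E] E by simp
    qed
    also have "\<dots> \<le> ennreal s * emeasure lebesgue E"
    proof (rule N.emeasure_off_superlevel[OF E bE _ assms])
      show "E \<inter> superlevel ?N s = {}" by (auto simp: E_def)
    qed
    finally show ?thesis .
  qed
  have "weight w E = (\<integral>\<^sup>+x. ennreal (w x - s) * indicator E x + ennreal s * indicator E x \<partial>lebesgue)"
    unfolding weight_def using assms
    by (intro nn_integral_cong) (auto simp: E_def split: split_indicator simp flip: ennreal_plus)
  also have "\<dots> = (\<integral>\<^sup>+x. ennreal (w x - s) * indicator E x \<partial>lebesgue) + ennreal s * emeasure lebesgue E"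
    by (subst nn_integral_add) (auto simp: nn_integral_cmult_indicator)
  finally have "(\<integral>\<^sup>+x. ennreal (w x - s) * indicator E x \<partial>lebesgue) + ennreal s * emeasure lebesgue E
      \<le> 0 + ennreal s * emeasure lebesgue E" using wE by simp
  then have "(\<integral>\<^sup>+x. ennreal (w x - s) * indicator E x \<partial>lebesgue) = 0"
    using fin unfolding add.commute[of _ "ennreal s * emeasure lebesgue E"] ennreal_add_left_cancel_le
    by (auto simp: ennreal_mult_eq_top_iff)
  then have "AE x in lebesgue. ennreal (w x - s) * indicator E x = 0"
    by (subst (asm) nn_integral_0_iff_AE) auto
  then have "AE x in lebesgue. x \<notin> E"
    by eventually_elim (auto simp: E_def indicator_def ennreal_eq_0_iff split: if_splits)
  then have "E \<in> null_sets lebesgue" using E by (simp add: AE_iff_null_sets)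
  then show ?thesis by (simp add: E_def)
qed

lemma weight_large_values_le:
  assumes "s \<ge> 0" "S \<subseteq> {a<..<b}" and [measurable]: "S \<in> sets lebesgue"
  shows "weight w {x\<in>S. s < w x} \<le> weight w (S \<inter> superlevel (restricted_weight w {a<..<b}) s)"
proof -
  have "AE x in lebesgue. x \<notin> {x\<in>{a<..<b}. s < w x} - superlevel (restricted_weight w {a<..<b}) s"
    using null_off_superlevel[OF assms(1)] by (rule AE_not_in)
  then show ?thesis unfolding weight_def
    using assms(2) by (intro nn_integral_mono_AE) (auto elim!: eventually_mono split: split_indicator)
qed

text \<open>
  Off the superlevel set of level \<open>s\<close>, \<open>w > s\<close> only on a null set; let \<open>s\<close> run through the nonnegative rationals.
\<close>

lemma AE_le_backward_max:
  "AE x in lebesgue. x \<in> {a<..<b} \<longrightarrow> ennreal (w x) \<le> backward_max (restricted_weight w {a<..<b}) x"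
proof -
  interpret N: continuous_finite_measure "restricted_weight w {a<..<b}" by (rule continuous_restricted_weight)
  let ?N = "restricted_weight w {a<..<b}"
  have "AE x in lebesgue. \<forall>s\<in>\<rat> \<inter> {0..}. x \<notin> {x\<in>{a<..<b}. s < w x} - superlevel ?N s"
    using null_off_superlevel by (intro AE_ball_countable[THEN iffD2] ballI AE_not_in) (auto intro: countable_subset countable_rat)
  then show ?thesis
  proof eventually_elim
    case (elim x)
    show ?case
    proof (intro impI, rule ccontr)
      assume x: "x \<in> {a<..<b}" and lt: "\<not> ennreal (w x) \<le> backward_max ?N x"
      then obtain m where m: "backward_max ?N x = ennreal m" "m \<ge> 0" "m < w x"
        by (cases "backward_max ?N x") (auto simp: not_le ennreal_less_iff top_unique)
      obtain s where s: "s \<in> \<rat>" "m < s" "s < w x" using Rats_dense_in_real[OF m(3)] by auto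
      then have "x \<in> superlevel ?N s" using elim x m by auto
      then have "ennreal s < backward_max ?N x" using N.less_backward_max_iff[of s x] s m by auto
      then show False using m s by (simp add: ennreal_less_iff)
    qed
  qed
qed

lemma weight_le_integral_backward_max:
  "weight w {a<..<b} \<le> (\<integral>\<^sup>+x\<in>{a<..<b}. backward_max (restricted_weight w {a<..<b}) x \<partial>lebesgue)"
  unfolding weight_def using AE_le_backward_max[of a b]
  by (intro nn_integral_mono_AE) (auto elim!: eventually_mono split: split_indicator)

text \<open>
  As \<open>M\<^sup>-\<close> dominates \<open>w\<close> almost everywhere, the constant is at least 1 unless all masses vanish.
\<close>

lemma A_infty_plus_const_cases:
  assumes "A_infty_plus w"
  obtains (null) "A_infty_plus_const w = 0" "\<And>a b. a < b \<Longrightarrow> weight w {a<..<b} = 0"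
    | (ge_1) A where "A_infty_plus_const w = ennreal A" "A \<ge> 1"
proof -
  obtain A where A: "A_infty_plus_const w = ennreal A" "A \<ge> 0"
    using assms by (cases "A_infty_plus_const w") (auto simp: A_infty_plus_def)
  show ?thesis
  proof (cases "A \<ge> 1")
    case False
    have zero: "weight w {a<..<b} = 0" if "a < b" for a b
    proof -
      obtain v where v: "weight w {a<..<b} = ennreal v" "v \<ge> 0"
        using weight_finite[of "{a<..<b}"] by (cases "weight w {a<..<b}") auto
      have "weight w {a<..<b} \<le> ennreal A * weight w {a<..<b}"
        using weight_le_integral_backward_max[of a b] A_infty_plus_bound[OF assms that] A by simp
      then have "v \<le> A * v" using v A by (simp flip: ennreal_mult)
      then have "v = 0" using False v(2) by (metis antisym mult_le_cancel_right1 not_less)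
      then show ?thesis using v by simp
    qed
    have "A_infty_plus_const w = 0"
    proof -
      have "(\<integral>\<^sup>+x\<in>{a<..<b}. maximal_minus (\<lambda>t. w t * indicator {a<..<b} t) x \<partial>lebesgue) = 0" if "a < b" for a b
        using A_infty_plus_bound[OF assms that] zero[OF that] by (simp add: maximal_minus_eq)
      then have "A_infty_plus_const w \<le> 0"
        unfolding A_infty_plus_const_def by (intro SUP_least) auto
      then show ?thesis by simp
    qed
    then show ?thesis using zero null by blast
  qed (use A ge_1 in blast)
qed

lemma restricted_weight_null_outside:
  "measure (restricted_weight w {a<..<b}) {..a} = 0" "measure (restricted_weight w {a<..<b}) {b<..} = 0"
proof -
  have "{..a} \<inter> {a<..<b} = {}" "{b<..} \<inter> {a<..<b} = {}" by auto
  then show "measure (restricted_weight w {a<..<b}) {..a} = 0" "measure (restricted_weight w {a<..<b}) {b<..} = 0"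
    by (simp_all add: measure_def emeasure_restricted_weight weight_def)
qed

end

section \<open>Layer cake integrals\<close>

lemma sigma_finite_lebesgue: "sigma_finite_measure (lebesgue :: real measure)"
proof (rule sigma_finite_measure.intro, intro exI conjI ballI)
  show "countable (range (\<lambda>n::nat. {- real n..real n}))" by simp
  show "range (\<lambda>n::nat. {- real n..real n}) \<subseteq> sets lebesgue" by auto
  show "\<Union> (range (\<lambda>n::nat. {- real n..real n})) = space lebesgue"
  proof -
    have "\<exists>n::nat. - real n \<le> x \<and> x \<le> real n" for x :: real
      using real_arch_simple[of "\<bar>x\<bar>"] by (auto simp: abs_le_iff) (metis minus_le_iff)
    then show ?thesis by auto
  qed
  show "emeasure lebesgue C \<noteq> \<infinity>" if "C \<in> range (\<lambda>n::nat. {- real n..real n})" for C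
    using that by auto
qed

lemma nn_integral_layers:
  fixes M :: "'a measure" and f :: "real \<Rightarrow> ennreal"
  assumes M: "sigma_finite_measure M" and f: "f \<in> borel_measurable lborel"
    and Q: "Q \<in> sets (M \<Otimes>\<^sub>M lborel)"
  shows "(\<integral>\<^sup>+x. (\<integral>\<^sup>+t. f t * indicator Q (x, t) \<partial>lborel) \<partial>M) = (\<integral>\<^sup>+t. f t * emeasure M {x. (x, t) \<in> Q} \<partial>lborel)"
proof -
  interpret pair_sigma_finite M lborel
    using M by (intro pair_sigma_finite.intro lborel.sigma_finite_measure_axioms)
  have meas: "(\<lambda>(x, t). f t * indicator Q (x, t)) \<in> borel_measurable (M \<Otimes>\<^sub>M lborel)"
    using f Q by measurable
  have sec: "{x. (x, t) \<in> Q} \<in> sets M" for t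
    using sets_Pair2[OF Q, of t] by (simp add: vimage_def)
  have "(\<integral>\<^sup>+x. (\<integral>\<^sup>+t. f t * indicator Q (x, t) \<partial>lborel) \<partial>M) = (\<integral>\<^sup>+t. (\<integral>\<^sup>+x. f t * indicator Q (x, t) \<partial>M) \<partial>lborel)"
    using Fubini'[OF meas] by simp
  also have "\<dots> = (\<integral>\<^sup>+t. f t * emeasure M {x. (x, t) \<in> Q} \<partial>lborel)"
  proof (rule nn_integral_cong)
    fix t
    have "(\<integral>\<^sup>+x. f t * indicator Q (x, t) \<partial>M) = (\<integral>\<^sup>+x. f t * indicator {x. (x, t) \<in> Q} x \<partial>M)"
      by (auto intro!: nn_integral_cong split: split_indicator)
    then show "(\<integral>\<^sup>+x. f t * indicator Q (x, t) \<partial>M) = f t * emeasure M {x. (x, t) \<in> Q}"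
      using nn_integral_cmult_indicator[OF sec] by simp
  qed
  finally show ?thesis .
qed

lemma nn_integral_powr_Ioo:
  assumes "0 < l" "l \<le> y" "e > 0"
  shows "(\<integral>\<^sup>+t\<in>{l<..<y}. ennreal (e * t powr (e - 1)) \<partial>lborel) = ennreal (y powr e - l powr e)"
proof -
  have "(\<integral>\<^sup>+t\<in>{l<..<y}. ennreal (e * t powr (e - 1)) \<partial>lborel) = (\<integral>\<^sup>+t\<in>{l..y}. ennreal (e * t powr (e - 1)) \<partial>lborel)"
    using AE_lborel_singleton[of l] AE_lborel_singleton[of y]
    by (intro nn_integral_cong_AE) (auto elim!: eventually_elim2 split: split_indicator)
  also have "\<dots> = ennreal (y powr e - l powr e)"
  proof (rule nn_integral_FTC_Icc)
    fix x assume x: "x \<in> {l..y}"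
    then show "((\<lambda>x. x powr e) has_real_derivative e * x powr (e - 1)) (at x)"
      using assms by (auto intro!: derivative_eq_intros)
    show "0 \<le> e * x powr (e - 1)" using assms by simp
  qed (use assms in auto)
  finally show ?thesis .
qed

lemma nn_integral_powr_tail:
  assumes "0 < l" "d > 0"
  shows "(\<integral>\<^sup>+t\<in>{l<..}. ennreal (t powr (- d - 1)) \<partial>lborel) = ennreal (l powr (- d) / d)"
proof -
  have "(\<integral>\<^sup>+t\<in>{l<..}. ennreal (t powr (- d - 1)) \<partial>lborel) = (\<integral>\<^sup>+t\<in>{l..}. ennreal (t powr (- d - 1)) \<partial>lborel)"
    using AE_lborel_singleton[of l]
    by (intro nn_integral_cong_AE) (auto elim!: eventually_mono split: split_indicator)
  also have "\<dots> = ennreal (0 - (- (l powr (- d) / d)))"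
  proof (rule nn_integral_FTC_atLeast)
    fix x assume x: "l \<le> x"
    then show "((\<lambda>x. - (x powr (- d) / d)) has_real_derivative x powr (- d - 1)) (at x)"
      using assms by (auto intro!: derivative_eq_intros)
  next
    \<comment> \<open>the antiderivative is normalised to vanish at infinity\<close>
    show "((\<lambda>x. - (x powr (- d) / d)) \<longlongrightarrow> 0) at_top"
      using tendsto_minus[OF tendsto_divide[OF tendsto_neg_powr[OF _ filterlim_ident, of "- d"] tendsto_const[of d]]] assms
      by simp
  qed (use assms in auto)
  finally show ?thesis by simp
qed

text \<open>
  A Gehring-type self-improvement for a function of one variable: write \<open>t\<^sup>e = l\<^sup>e + \<integral>\<^sub>l\<^sup>t e s\<^sup>e\<^sup>-\<^sup>1 ds\<close>, exchange the
  integrals, and apply the tail bound for each \<open>s\<close>.  The moment \<open>T = \<integral> t\<^sup>e u\<close> comes back with the factor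
  \<open>e B \<le> 1/2\<close> and is absorbed on the left.  Absorption needs \<open>T < \<infinity>\<close>, so the integrals are first
  truncated at \<open>L\<close>.
\<close>

lemma tail_bound_imp_powr_bound:
  fixes u :: "real \<Rightarrow> ennreal"
  assumes u[measurable]: "u \<in> borel_measurable lborel"
    and l: "0 < l" and B: "B \<ge> 0" and e: "e > 0" "e * B \<le> 1 / 2"
    and mono: "\<And>t. l \<le> t \<Longrightarrow> u t \<le> u l" and fin: "u l < \<infinity>"
    and tail: "\<And>s. l \<le> s \<Longrightarrow> (\<integral>\<^sup>+t\<in>{s<..}. u t \<partial>lborel) \<le> ennreal (B * s) * u s"
  shows "ennreal e * (\<integral>\<^sup>+t\<in>{l<..}. ennreal (t powr e) * u t \<partial>lborel) \<le> ennreal (l powr (1 + e)) * u l"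
proof -
  have trunc: "ennreal e * (\<integral>\<^sup>+t\<in>{l<..<L}. ennreal (t powr e) * u t \<partial>lborel) \<le> ennreal (l powr (1 + e)) * u l"
    if L: "l \<le> L" for L
  proof -
    let ?T = "\<integral>\<^sup>+t\<in>{l<..<L}. ennreal (t powr e) * u t \<partial>lborel"
    let ?k = "\<lambda>s t. (if l < s \<and> s < t \<and> t < L then ennreal (e * s powr (e - 1)) * u t else 0)"
    have "?T = (\<integral>\<^sup>+t. (\<integral>\<^sup>+s. ?k s t \<partial>lborel) + ennreal (l powr e) * (u t * indicator {l<..<L} t) \<partial>lborel)"
    proof (rule nn_integral_cong)
      fix t
      show "ennreal (t powr e) * u t * indicator {l<..<L} t
        = (\<integral>\<^sup>+s. ?k s t \<partial>lborel) + ennreal (l powr e) * (u t * indicator {l<..<L} t)"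
      proof (cases "t \<in> {l<..<L}")
        case True
        have "(\<integral>\<^sup>+s. ?k s t \<partial>lborel) = (\<integral>\<^sup>+s. u t * (ennreal (e * s powr (e - 1)) * indicator {l<..<t} s) \<partial>lborel)"
          using True by (intro nn_integral_cong) (auto split: split_indicator simp: mult.commute)
        also have "\<dots> = u t * ennreal (t powr e - l powr e)"
          using True l e by (subst nn_integral_cmult) (auto simp: nn_integral_powr_Ioo)
        finally have "(\<integral>\<^sup>+s. ?k s t \<partial>lborel) + ennreal (l powr e) * u t = u t * (ennreal (t powr e - l powr e) + ennreal (l powr e))"
          by (simp add: distrib_left mult.commute)
        also have "ennreal (t powr e - l powr e) + ennreal (l powr e) = ennreal (t powr e)"
          using True l e by (subst ennreal_plus[symmetric]) (auto intro: powr_mono2)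
        finally show ?thesis using True by (simp add: mult.commute)
      next
        case False
        then have "(\<integral>\<^sup>+s. ?k s t \<partial>lborel) = (\<integral>\<^sup>+s. 0 \<partial>(lborel::real measure))" by (intro nn_integral_cong) auto
        with False show ?thesis by simp
      qed
    qed
    also have "\<dots> = (\<integral>\<^sup>+t. (\<integral>\<^sup>+s. ?k s t \<partial>lborel) \<partial>lborel) + ennreal (l powr e) * (\<integral>\<^sup>+t\<in>{l<..<L}. u t \<partial>lborel)"
      by (subst nn_integral_add) (auto simp: nn_integral_cmult)
    also have "(\<integral>\<^sup>+t. (\<integral>\<^sup>+s. ?k s t \<partial>lborel) \<partial>lborel) = (\<integral>\<^sup>+s. (\<integral>\<^sup>+t. ?k s t \<partial>lborel) \<partial>lborel)"
      by (rule lborel_pair.Fubini') measurable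
    also have "\<dots> \<le> (\<integral>\<^sup>+s. ennreal (e * B) * (ennreal (s powr e) * u s * indicator {l<..<L} s) \<partial>lborel)"
    proof (rule nn_integral_mono)
      fix s
      show "(\<integral>\<^sup>+t. ?k s t \<partial>lborel) \<le> ennreal (e * B) * (ennreal (s powr e) * u s * indicator {l<..<L} s)"
      proof (cases "s \<in> {l<..<L}")
        case True
        have "(\<integral>\<^sup>+t. ?k s t \<partial>lborel) \<le> (\<integral>\<^sup>+t. ennreal (e * s powr (e - 1)) * (u t * indicator {s<..} t) \<partial>lborel)"
          by (intro nn_integral_mono) (auto split: split_indicator)
        also have "\<dots> = ennreal (e * s powr (e - 1)) * (\<integral>\<^sup>+t\<in>{s<..}. u t \<partial>lborel)"
          by (rule nn_integral_cmult) auto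
        also have "\<dots> \<le> ennreal (e * s powr (e - 1)) * (ennreal (B * s) * u s)"
          using True by (intro mult_left_mono tail) auto
        also have "\<dots> = ennreal (e * s powr (e - 1) * (B * s)) * u s"
          using True l e B by (subst ennreal_mult) (auto simp: mult.assoc)
        also have "e * s powr (e - 1) * (B * s) = e * B * s powr e"
          using True l by (simp add: powr_diff)
        also have "ennreal (e * B * s powr e) * u s = ennreal (e * B) * (ennreal (s powr e) * u s)"
          using e B by (subst ennreal_mult) (auto simp: mult.assoc)
        finally show ?thesis using True by simp
      next
        case False
        then have "(\<integral>\<^sup>+t. ?k s t \<partial>lborel) = (\<integral>\<^sup>+t. 0 \<partial>(lborel::real measure))" by (intro nn_integral_cong) auto
        then show ?thesis by simp
      qed
    qed
    also have "\<dots> = ennreal (e * B) * ?T" by (rule nn_integral_cmult) auto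
    also have "(\<integral>\<^sup>+t\<in>{l<..<L}. u t \<partial>lborel) \<le> (\<integral>\<^sup>+t\<in>{l<..}. u t \<partial>lborel)"
      by (intro nn_integral_mono) (auto split: split_indicator)
    also have "\<dots> \<le> ennreal (B * l) * u l" by (rule tail) simp
    finally have main: "?T \<le> ennreal (e * B) * ?T + ennreal (l powr e) * (ennreal (B * l) * u l)"
      by (simp add: add_left_mono add_right_mono mult_left_mono)
    have "?T \<le> (\<integral>\<^sup>+t. ennreal (L powr e) * u l * indicator {l<..<L} t \<partial>lborel)"
      using l e L by (intro nn_integral_mono) (auto split: split_indicator intro!: mult_mono mono ennreal_leI powr_mono2)
    also have "\<dots> < \<infinity>"
      using fin L by (subst nn_integral_cmult_indicator) (auto simp: ennreal_mult_less_top)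
    finally obtain r where r: "?T = ennreal r" "r \<ge> 0" by (cases ?T) auto
    obtain v where v: "u l = ennreal v" "v \<ge> 0" using fin by (cases "u l") auto
    have "r \<le> e * B * r + l powr e * (B * l * v)"
      using main r v e B l by (simp flip: ennreal_mult ennreal_plus)
    then have "e * r \<le> e * B * (e * r) + e * B * (l powr e * l * v)"
      using mult_left_mono[of r "e * B * r + l powr e * (B * l * v)" e] e by (simp add: algebra_simps)
    also have "\<dots> \<le> 1 / 2 * (e * r) + 1 / 2 * (l powr e * l * v)"
      using e r v l by (intro add_mono mult_right_mono) auto
    finally have "e * r \<le> l powr (1 + e) * v" using l by (simp add: powr_add mult.commute)
    then show ?thesis using e r v by (simp flip: ennreal_mult)
  qed
  let ?D = "density lborel (\<lambda>t. ennreal (t powr e) * u t)"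
  have exhaust: "{l<..} = (\<Union>n. {l<..<l + real n})"
  proof -
    have "\<exists>n. x < l + real n" for x using reals_Archimedean2[of "x - l"] by (auto simp: algebra_simps)
    then show ?thesis by auto
  qed
  have "(\<integral>\<^sup>+t\<in>{l<..}. ennreal (t powr e) * u t \<partial>lborel) = emeasure ?D {l<..}"
    by (subst emeasure_density) auto
  also have "\<dots> = (SUP n. emeasure ?D {l<..<l + real n})"
    unfolding exhaust by (intro SUP_emeasure_incseq[symmetric]) (auto simp: incseq_def)
  also have "\<dots> = (SUP n. \<integral>\<^sup>+t\<in>{l<..<l + real n}. ennreal (t powr e) * u t \<partial>lborel)"
    by (subst emeasure_density) auto
  finally have eq: "(\<integral>\<^sup>+t\<in>{l<..}. ennreal (t powr e) * u t \<partial>lborel)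
    = (SUP n. \<integral>\<^sup>+t\<in>{l<..<l + real n}. ennreal (t powr e) * u t \<partial>lborel)" .
  show ?thesis
    unfolding eq SUP_mult_left_ennreal by (intro SUP_least trunc) simp
qed

section \<open>The reverse Hoelder inequality\<close>

lemma open_in_sets_pair_lborel:
  fixes Q :: "(real \<times> real) set" and M :: "real measure"
  assumes "open Q" "sets M = sets lebesgue"
  shows "Q \<in> sets (M \<Otimes>\<^sub>M lborel)"
proof -
  have id: "(\<lambda>x. x) \<in> M \<rightarrow>\<^sub>M borel"
    using assms(2) by (simp add: measurable_def sets_eq_imp_space_eq[OF assms(2)])
  have "(\<lambda>p. (fst p, snd p)) \<in> (M \<Otimes>\<^sub>M lborel) \<rightarrow>\<^sub>M (borel \<Otimes>\<^sub>M borel)"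
    by (intro measurable_Pair measurable_compose[OF measurable_fst id] measurable_compose[OF measurable_snd]) simp
  then have "(\<lambda>p. p) \<in> (M \<Otimes>\<^sub>M lborel) \<rightarrow>\<^sub>M (borel :: (real \<times> real) measure)"
    by (simp add: borel_prod)
  from measurable_sets[OF this borel_open[OF assms(1)]]
  show ?thesis by (simp add: space_pair_measure sets_eq_imp_space_eq[OF assms(2)])
qed

lemma emeasure_eq_by_components:
  fixes M N :: "real measure"
  assumes "countable \<C>" "disjoint_family_on (\<lambda>C. C) \<C>"
    and "\<And>C. C \<in> \<C> \<Longrightarrow> C \<in> sets M" "\<And>C. C \<in> \<C> \<Longrightarrow> C \<in> sets N"
    and "\<And>C. C \<in> \<C> \<Longrightarrow> emeasure M C = emeasure N C"
  shows "emeasure M (\<Union>\<C>) = emeasure N (\<Union>\<C>)"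
proof (rule antisym)
  show "emeasure M (\<Union>\<C>) \<le> emeasure N (\<Union>\<C>)"
    by (rule emeasure_le_by_components[OF assms(1,2)]) (auto simp: assms(3-5))
  show "emeasure N (\<Union>\<C>) \<le> emeasure M (\<Union>\<C>)"
    by (rule emeasure_le_by_components[OF assms(1,2)]) (auto simp: assms(3-5))
qed

context continuous_finite_measure begin

lemma open_superlevel_graph: "open {(x, t). x \<in> superlevel N t}"
proof -
  have "{(x, t). x \<in> superlevel N t} = (\<Union>s. superlevel N s \<times> {..<s})"
  proof (rule set_eqI)
    fix z :: "real \<times> real"
    obtain x t where z: "z = (x, t)" by (cases z)
    have "x \<in> superlevel N t \<longleftrightarrow> (\<exists>s>t. x \<in> superlevel N s)" by (subst superlevel_Union) auto
    then show "z \<in> {(x, t). x \<in> superlevel N t} \<longleftrightarrow> z \<in> (\<Union>s. superlevel N s \<times> {..<s})"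
      unfolding z by simp blast
  qed
  also have "open \<dots>" by (intro open_UN ballI open_Times open_superlevel open_lessThan)
  finally show ?thesis .
qed

lemma open_left_superlevel_graph: "open {(x, t). x \<in> left_superlevel N b t}"
proof -
  have "{(x, t). x \<in> left_superlevel N b t} = (\<Union>s. left_superlevel N b s \<times> {..<s})"
  proof (rule set_eqI)
    fix z :: "real \<times> real"
    obtain x t where z: "z = (x, t)" by (cases z)
    have "x \<in> left_superlevel N b t \<longleftrightarrow> (\<exists>s>t. x \<in> left_superlevel N b s)" by (subst left_superlevel_Union) auto
    then show "z \<in> {(x, t). x \<in> left_superlevel N b t} \<longleftrightarrow> z \<in> (\<Union>s. left_superlevel N b s \<times> {..<s})"
      unfolding z by simp blast
  qed
  also have "open \<dots>" by (intro open_UN ballI open_Times open_left_superlevel open_lessThan)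
  finally show ?thesis .
qed

lemma emeasure_left_superlevel_measurable:
  "(\<lambda>t. emeasure lebesgue (left_superlevel N b t)) \<in> borel_measurable lborel"
proof -
  interpret pair_sigma_finite "lebesgue :: real measure" "lborel :: real measure"
    by (intro pair_sigma_finite.intro lborel.sigma_finite_measure_axioms sigma_finite_lebesgue)
  show ?thesis
    using measurable_emeasure_Pair2[OF open_in_sets_pair_lborel[OF open_left_superlevel_graph[of b] refl]]
    by (simp add: vimage_def)
qed

text \<open>
  On the set of level \<open>s\<close> the maximal function is at least \<open>s\<close> plus the length of the set of the levels
  \<open>t > s\<close> whose sets still contain the point.
\<close>

lemma layers_le_integral_backward_max:
  assumes s: "s \<ge> 0"
  shows "ennreal s * emeasure lebesgue (left_superlevel N b s)
      + (\<integral>\<^sup>+t\<in>{s<..}. emeasure lebesgue (left_superlevel N b t) \<partial>lborel)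
    \<le> (\<integral>\<^sup>+x\<in>left_superlevel N b s. backward_max N x \<partial>lebesgue)"
proof -
  let ?Q = "{(x, t). x \<in> left_superlevel N b t}"
  let ?inner = "\<lambda>x. \<integral>\<^sup>+t. indicator {s<..} t * indicator ?Q (x, t) \<partial>lborel"
  have Q: "?Q \<in> sets (lebesgue \<Otimes>\<^sub>M lborel)"
    by (rule open_in_sets_pair_lborel[OF open_left_superlevel_graph refl])
  have \<Omega>[measurable]: "left_superlevel N b s \<in> sets lebesgue" using open_left_superlevel by simp
  have inner: "?inner \<in> borel_measurable lebesgue"
    using Q by measurable
  have "(\<integral>\<^sup>+t\<in>{s<..}. emeasure lebesgue (left_superlevel N b t) \<partial>lborel)
      = (\<integral>\<^sup>+t. indicator {s<..} t * emeasure lebesgue {x. (x, t) \<in> ?Q} \<partial>lborel)"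
    by (simp add: mult.commute)
  also have "\<dots> = (\<integral>\<^sup>+x. ?inner x \<partial>lebesgue)"
    by (rule nn_integral_layers[OF sigma_finite_lebesgue _ Q, symmetric]) simp
  finally have "ennreal s * emeasure lebesgue (left_superlevel N b s)
      + (\<integral>\<^sup>+t\<in>{s<..}. emeasure lebesgue (left_superlevel N b t) \<partial>lborel)
    = (\<integral>\<^sup>+x. ennreal s * indicator (left_superlevel N b s) x + ?inner x \<partial>lebesgue)"
    using inner by (subst nn_integral_add) (auto simp: nn_integral_cmult_indicator)
  also have "\<dots> \<le> (\<integral>\<^sup>+x\<in>left_superlevel N b s. backward_max N x \<partial>lebesgue)"
  proof (rule nn_integral_mono)
    fix x
    show "ennreal s * indicator (left_superlevel N b s) x + ?inner x \<le> backward_max N x * indicator (left_superlevel N b s) x"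
    proof (cases "x \<in> left_superlevel N b s")
      case False
      then have "?inner x = (\<integral>\<^sup>+t. 0 \<partial>(lborel::real measure))"
        using subsetD[OF left_superlevel_mono[OF less_imp_le, of s _ b]]
        by (intro nn_integral_cong) (auto split: split_indicator)
      with False show ?thesis by simp
    next
      case True
      show ?thesis
      proof (cases "backward_max N x")
        case (real m)
        have lt: "t < m" if "t \<ge> 0" "x \<in> left_superlevel N b t" for t
        proof -
          have "ennreal t < backward_max N x"
            using less_backward_max_iff[OF that(1)] that(2) left_superlevel_subset[of b t] by auto
          then show ?thesis using real that by (simp add: ennreal_less_iff)
        qed
        have "?inner x \<le> (\<integral>\<^sup>+t. indicator {s<..<m} t \<partial>lborel)"
          using lt s by (intro nn_integral_mono) (auto split: split_indicator)
        also have "\<dots> = ennreal (m - s)" using lt[OF s True] by simp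
        finally have "ennreal s + ?inner x \<le> ennreal s + ennreal (m - s)" by (rule add_left_mono)
        also have "\<dots> = ennreal m" using lt[OF s True] s by (simp flip: ennreal_plus)
        finally show ?thesis using True real by simp
      qed (use True in simp)
    qed
  qed
  finally show ?thesis .
qed

end

context weight_function begin

text \<open>
  On every component \<open>(p, q)\<close> the weight has average \<open>s\<close>, and the maximal function there is that of \<open>w\<close>
  restricted to \<open>(p, q)\<close>, so the \<open>A\<^sub>\<infinity>\<^sup>+\<close> condition on \<open>(p, q)\<close> bounds its integral.
\<close>

lemma left_superlevel_estimates:
  assumes "A_infty_plus w" and A: "A_infty_plus_const w = ennreal A" "A \<ge> 0"
    and abc: "a < b" "b < c" and s: "s > 0" "enn2real (weight w {a<..<c}) \<le> s * (c - b)"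
  defines "\<Omega> \<equiv> left_superlevel (restricted_weight w {a<..<c}) b"
  shows "\<Omega> s \<subseteq> {a<..<c}"
    and "weight w (\<Omega> s) = ennreal s * emeasure lebesgue (\<Omega> s)"
    and "(\<integral>\<^sup>+x\<in>\<Omega> s. backward_max (restricted_weight w {a<..<c}) x \<partial>lebesgue) \<le> ennreal (A * s) * emeasure lebesgue (\<Omega> s)"
proof -
  let ?N = "restricted_weight w {a<..<c}"
  interpret N: continuous_finite_measure ?N by (rule continuous_restricted_weight)
  have "measure ?N UNIV \<le> s * (c - b)"
    using s(2) by (simp add: measure_def emeasure_restricted_weight)
  from N.left_superlevel_components[OF abc s(1) restricted_weight_null_outside this]
  obtain \<C> where \<C>: "countable \<C>" "disjoint_family_on (\<lambda>C. C) \<C>" "\<Union>\<C> = \<Omega> s"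
    and "\<forall>C\<in>\<C>. \<exists>p q. p < q \<and> C = {p<..<q} \<and> C \<subseteq> superlevel ?N s \<and> p \<notin> superlevel ?N s \<and> q \<notin> superlevel ?N s
        \<and> a \<le> p \<and> q \<le> c"
    unfolding \<Omega>_def by metis
  then have comp: "\<exists>p q. p < q \<and> C = {p<..<q} \<and> C \<subseteq> superlevel ?N s \<and> p \<notin> superlevel ?N s \<and> q \<notin> superlevel ?N s
        \<and> a \<le> p \<and> q \<le> c" if "C \<in> \<C>" for C using that by blast
  have "C \<subseteq> {a<..<c}" if "C \<in> \<C>" for C using comp[OF that] by auto
  then show sub: "\<Omega> s \<subseteq> {a<..<c}" unfolding \<C>(3)[symmetric] by blast
  have \<Omega>: "\<Omega> s \<in> sets lebesgue" using N.open_left_superlevel unfolding \<Omega>_def by simp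
  have Nw: "emeasure ?N S = weight w S" if "S \<in> sets lebesgue" "S \<subseteq> {a<..<c}" for S
    using that by (simp add: emeasure_restricted_weight Int_absorb2)
  have sets: "C \<in> sets lebesgue" if "C \<in> \<C>" for C using comp[OF that] by auto
  have NC: "emeasure ?N C = ennreal s * emeasure lebesgue C" if "C \<in> \<C>" for C
    using comp[OF that] N.rising_sun_eq[of _ _ s] s(1)
    by (auto simp: N.emeasure_eq_measure simp flip: ennreal_mult)
  have "emeasure ?N (\<Union>\<C>) = emeasure (scale_measure (ennreal s) lebesgue) (\<Union>\<C>)"
    by (rule emeasure_eq_by_components[OF \<C>(1,2)]) (auto simp: sets NC)
  then show weight: "weight w (\<Omega> s) = ennreal s * emeasure lebesgue (\<Omega> s)"
    using Nw[OF \<Omega> sub] by (simp add: \<C>(3))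
  let ?D = "density lebesgue (backward_max ?N)"
  have "emeasure ?D (\<Union>\<C>) \<le> emeasure (scale_measure (ennreal A) ?N) (\<Union>\<C>)"
  proof (rule emeasure_le_by_components[OF \<C>(1,2)])
    fix C assume C: "C \<in> \<C>"
    show "C \<in> sets ?D" "C \<in> sets (scale_measure (ennreal A) ?N)" using sets[OF C] by auto
    from comp[OF C] obtain p q where pq: "p < q" "C = {p<..<q}" "C \<subseteq> superlevel ?N s" "p \<notin> superlevel ?N s"
      "a \<le> p" "q \<le> c" by blast
    have loc: "backward_max ?N x \<le> backward_max (restricted_weight w {p<..<q}) x" if "x \<in> {p<..<q}" for x
    proof -
      have "{x - h..x} \<inter> {p<..<q} \<inter> {a<..<c} = {x - h..x} \<inter> {p<..<q}" for h using pq by auto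
      then have "(SUP h\<in>{0<..}. (1 / ennreal h) * emeasure ?N ({x - h..x} \<inter> {p<..<q}))
        = backward_max (restricted_weight w {p<..<q}) x"
        unfolding backward_max_def by (simp add: emeasure_restricted_weight)
      then show ?thesis using N.backward_max_localise[of p q s x] pq that by simp
    qed
    have "emeasure ?D C = (\<integral>\<^sup>+x\<in>C. backward_max ?N x \<partial>lebesgue)"
      using sets[OF C] by (intro emeasure_density N.backward_max_measurable)
    also have "\<dots> \<le> (\<integral>\<^sup>+x\<in>C. backward_max (restricted_weight w {p<..<q}) x \<partial>lebesgue)"
      using loc pq(2) by (intro nn_integral_mono) (auto split: split_indicator)
    also have "\<dots> \<le> ennreal A * weight w C"
      using A_infty_plus_bound[OF assms(1) pq(1)] A pq(2) by simp
    also have "\<dots> = emeasure (scale_measure (ennreal A) ?N) C"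
    proof -
      have "C \<subseteq> {a<..<c}" using pq by auto
      then show ?thesis using Nw[OF sets[OF C]] by simp
    qed
    finally show "emeasure ?D C \<le> emeasure (scale_measure (ennreal A) ?N) C" .
  qed
  then have "emeasure ?D (\<Omega> s) \<le> ennreal A * weight w (\<Omega> s)"
    using Nw[OF \<Omega> sub] by (simp add: \<C>(3))
  then show "(\<integral>\<^sup>+x\<in>\<Omega> s. backward_max ?N x \<partial>lebesgue) \<le> ennreal (A * s) * emeasure lebesgue (\<Omega> s)"
    using A(2) s(1) unfolding weight emeasure_density[OF N.backward_max_measurable \<Omega>]
    by (simp add: ennreal_mult mult.assoc)
qed

lemma AE_zero_of_weight_zero:
  assumes "weight w {a<..<b} = 0"
  shows "AE x in lebesgue. x \<in> {a<..<b} \<longrightarrow> w x = 0"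
proof -
  have "(\<lambda>t. ennreal (w t) * indicator {a<..<b} t) \<in> borel_measurable lebesgue"
    by (intro borel_measurable_times_ennreal measurable_compose[OF w_measurable measurable_ennreal]
       borel_measurable_indicator) auto
  then have "AE t in lebesgue. ennreal (w t) * indicator {a<..<b} t = 0"
    using assms unfolding weight_def by (simp add: nn_integral_0_iff_AE)
  then show ?thesis by eventually_elim (use nonneg in \<open>auto simp: ennreal_eq_0_iff antisym\<close>)
qed

text \<open>
  Let \<open>V = w(a, c)\<close>, \<open>l = V / (c - b)\<close> and let \<open>u t\<close> be the measure of the left superlevel set of level \<open>t \<ge> l\<close>.
  Comparing the lower and the upper bound for the integral of the maximal function gives
  \<open>s u(s) + \<integral>\<^sub>s\<^sup>\<infinity> u \<le> A s u(s)\<close>, hence the tail bound with \<open>B = A - 1\<close> and a bound for \<open>\<epsilon> \<integral> t\<^sup>\<epsilon> u\<close>.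
  By the layer cake formula for \<open>w\<^sup>\<epsilon>\<close> with respect to \<open>w dx\<close>, this integral controls the part of
  \<open>\<integral> w\<^sup>1\<^sup>+\<^sup>\<epsilon>\<close> above the level \<open>l\<close>.  The parts below and above \<open>l\<close> contribute \<open>l\<^sup>\<epsilon> V\<close> at most each, whence the
  factor 2.
\<close>

lemma reverse_Hoelder_interval:
  assumes "A_infty_plus w" and A: "A_infty_plus_const w = ennreal A" "A \<ge> 1"
    and \<epsilon>: "\<epsilon> > 0" "\<epsilon> * A \<le> 1 / 2" and abc: "a < b" "b < c"
  shows "ennreal ((c - b) powr \<epsilon>) * (\<integral>\<^sup>+t\<in>{a<..<b}. ennreal (w t powr (1 + \<epsilon>)) \<partial>lebesgue)
      \<le> 2 * ennreal (enn2real (weight w {a<..<c}) powr (1 + \<epsilon>))"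
proof -
  let ?N = "restricted_weight w {a<..<c}" and ?D = "restricted_weight w {a<..<b}"
  interpret N: continuous_finite_measure ?N by (rule continuous_restricted_weight)
  interpret D: continuous_finite_measure ?D by (rule continuous_restricted_weight)
  define V where "V = enn2real (weight w {a<..<c})"
  have V: "weight w {a<..<c} = ennreal V" "V \<ge> 0"
    using weight_finite[of "{a<..<c}"] by (simp_all add: V_def less_top)
  show ?thesis
  proof (cases "V = 0")
    case True
    then have "AE x in lebesgue. x \<in> {a<..<c} \<longrightarrow> w x = 0" using V by (intro AE_zero_of_weight_zero) simp
    then have "(\<integral>\<^sup>+t\<in>{a<..<b}. ennreal (w t powr (1 + \<epsilon>)) \<partial>lebesgue) = (\<integral>\<^sup>+t. 0 \<partial>(lebesgue :: real measure))"
      using abc by (intro nn_integral_cong_AE) (auto elim!: eventually_mono split: split_indicator)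
    then show ?thesis by simp
  next
    case False
    define l where "l = V / (c - b)"
    have l: "l > 0" using False V abc by (simp add: l_def)
    have large: "enn2real (weight w {a<..<c}) \<le> s * (c - b)" if "l \<le> s" for s
      using that abc unfolding V_def[symmetric] l_def by (simp add: field_simps)
    define \<Omega> where "\<Omega> = left_superlevel ?N b"
    define u where "u t = emeasure lebesgue (\<Omega> t)" for t
    have A0: "A \<ge> 0" using A by simp
    note est = left_superlevel_estimates[OF assms(1) A(1) A0 abc _ large, folded \<Omega>_def]
    have u_meas: "u \<in> borel_measurable lborel"
      using N.emeasure_left_superlevel_measurable[of b] unfolding u_def \<Omega>_def .
    have fin: "u s < \<infinity>" if "l \<le> s" for s
    proof -
      have "u s \<le> emeasure lebesgue {a<..<c}"
        unfolding u_def using est(1)[of s] l that by (intro emeasure_mono) auto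
      also have "\<dots> < \<infinity>" using abc by simp
      finally show ?thesis .
    qed
    have "ennreal \<epsilon> * (\<integral>\<^sup>+t\<in>{l<..}. ennreal (t powr \<epsilon>) * u t \<partial>lborel) \<le> ennreal (l powr (1 + \<epsilon>)) * u l"
    proof (rule tail_bound_imp_powr_bound[OF u_meas l, where B="A - 1"])
      show "\<epsilon> * (A - 1) \<le> 1 / 2" using \<epsilon> by (simp add: algebra_simps)
      show "u t \<le> u l" if "l \<le> t" for t
        unfolding u_def \<Omega>_def using N.open_left_superlevel by (intro emeasure_mono N.left_superlevel_mono that) auto
      show "(\<integral>\<^sup>+t\<in>{s<..}. u t \<partial>lborel) \<le> ennreal ((A - 1) * s) * u s" if "l \<le> s" for s
      proof -
        have s: "s > 0" using that l by simp
        have "ennreal s * u s + (\<integral>\<^sup>+t\<in>{s<..}. u t \<partial>lborel)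
            \<le> (\<integral>\<^sup>+x\<in>\<Omega> s. backward_max ?N x \<partial>lebesgue)"
          unfolding u_def \<Omega>_def using s by (intro N.layers_le_integral_backward_max) auto
        also have "\<dots> \<le> ennreal (A * s) * u s" unfolding u_def using est(3)[OF s that] .
        also have "ennreal (A * s) = ennreal s + ennreal ((A - 1) * s)"
          using s A by (subst ennreal_plus[symmetric]) (auto simp: algebra_simps)
        finally show ?thesis
          using fin[OF that] by (auto simp: distrib_right ennreal_add_left_cancel_le ennreal_mult_eq_top_iff)
      qed
    qed (use A \<epsilon> fin in auto)
    note powr_bound = this
    let ?Q = "{(x, t). t < w x}"
    have w_D: "w \<in> borel_measurable ?D" by (simp add: measurable_def restricted_weight_def w_measurable[unfolded measurable_def, simplified])
    have Q: "?Q \<in> sets (?D \<Otimes>\<^sub>M lborel)"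
    proof -
      have "{p \<in> space (?D \<Otimes>\<^sub>M lborel). snd p < w (fst p)} \<in> sets (?D \<Otimes>\<^sub>M lborel)"
        using w_D by measurable
      also have "{p \<in> space (?D \<Otimes>\<^sub>M lborel). snd p < w (fst p)} = ?Q"
        by (auto simp: space_pair_measure restricted_weight_def)
      finally show ?thesis .
    qed
    let ?f = "\<lambda>t. ennreal (\<epsilon> * t powr (\<epsilon> - 1)) * indicator {l<..} t"
    have "(\<integral>\<^sup>+t\<in>{a<..<b}. ennreal (w t powr (1 + \<epsilon>)) \<partial>lebesgue) = (\<integral>\<^sup>+x. ennreal (w x powr \<epsilon>) \<partial>?D)"
    proof -
      have "(\<lambda>x. ennreal (w x powr \<epsilon>)) \<in> borel_measurable lebesgue" using w_measurable by measurable
      then have "(\<integral>\<^sup>+x. ennreal (w x powr \<epsilon>) \<partial>?D) = (\<integral>\<^sup>+x. ennreal (w x * indicator {a<..<b} x) * ennreal (w x powr \<epsilon>) \<partial>lebesgue)"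
        unfolding restricted_weight_def by (intro nn_integral_density restricted_density_measurable) auto
      also have "\<dots> = (\<integral>\<^sup>+t\<in>{a<..<b}. ennreal (w t powr (1 + \<epsilon>)) \<partial>lebesgue)"
        using nonneg by (intro nn_integral_cong) (auto split: split_indicator simp: powr_add simp flip: ennreal_mult)
      finally show ?thesis by simp
    qed
    also have "\<dots> \<le> (\<integral>\<^sup>+x. ennreal (l powr \<epsilon>) + (\<integral>\<^sup>+t. ?f t * indicator ?Q (x, t) \<partial>lborel) \<partial>?D)"
    proof (rule nn_integral_mono)
      fix x
      show "ennreal (w x powr \<epsilon>) \<le> ennreal (l powr \<epsilon>) + (\<integral>\<^sup>+t. ?f t * indicator ?Q (x, t) \<partial>lborel)"
      proof (cases "w x \<le> l")
        case True
        then have "ennreal (w x powr \<epsilon>) \<le> ennreal (l powr \<epsilon>)" using nonneg \<epsilon> by (intro ennreal_leI powr_mono2) auto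
        then show ?thesis by (rule order_trans) simp
      next
        case False
        have "(\<integral>\<^sup>+t. ?f t * indicator ?Q (x, t) \<partial>lborel) = (\<integral>\<^sup>+t\<in>{l<..<w x}. ennreal (\<epsilon> * t powr (\<epsilon> - 1)) \<partial>lborel)"
          by (intro nn_integral_cong) (auto split: split_indicator)
        also have "\<dots> = ennreal (w x powr \<epsilon> - l powr \<epsilon>)" using False l \<epsilon> by (intro nn_integral_powr_Ioo) auto
        finally show ?thesis using False l \<epsilon> by (simp add: powr_mono2 flip: ennreal_plus)
      qed
    qed
    also have "\<dots> = ennreal (l powr \<epsilon>) * emeasure ?D UNIV + (\<integral>\<^sup>+t. ?f t * emeasure ?D {x. (x, t) \<in> ?Q} \<partial>lborel)"
    proof -
      have "(\<integral>\<^sup>+x. (\<integral>\<^sup>+t. ?f t * indicator ?Q (x, t) \<partial>lborel) \<partial>?D) = (\<integral>\<^sup>+t. ?f t * emeasure ?D {x. (x, t) \<in> ?Q} \<partial>lborel)"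
        by (rule nn_integral_layers[OF D.sigma_finite_measure_axioms _ Q]) simp
      moreover have "(\<lambda>x. \<integral>\<^sup>+t. ?f t * indicator ?Q (x, t) \<partial>lborel) \<in> borel_measurable ?D"
        using Q by measurable
      moreover have "space ?D = UNIV" by (simp add: restricted_weight_def)
      ultimately show ?thesis by (subst nn_integral_add) auto
    qed
    also have "emeasure ?D UNIV \<le> ennreal V"
      using weight_mono[of "{a<..<b}" "{a<..<c}"] abc V by (simp add: emeasure_restricted_weight greaterThanLessThan_subseteq_greaterThanLessThan)
    also have "(\<integral>\<^sup>+t. ?f t * emeasure ?D {x. (x, t) \<in> ?Q} \<partial>lborel) \<le> (\<integral>\<^sup>+t. ennreal \<epsilon> * (ennreal (t powr \<epsilon>) * u t * indicator {l<..} t) \<partial>lborel)"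
    proof (rule nn_integral_mono)
      fix t
      show "?f t * emeasure ?D {x. (x, t) \<in> ?Q} \<le> ennreal \<epsilon> * (ennreal (t powr \<epsilon>) * u t * indicator {l<..} t)"
      proof (cases "l < t")
        case True
        then have t: "t > 0" "l \<le> t" using l by auto
        have "{x \<in> space lebesgue. t < w x} \<in> sets lebesgue" using w_measurable by measurable
        then have "{x. t < w x} \<in> sets lebesgue" by simp
        then have "emeasure ?D {x. (x, t) \<in> ?Q} = weight w ({x. t < w x} \<inter> {a<..<b})"
          by (simp add: emeasure_restricted_weight)
        also have "{x. t < w x} \<inter> {a<..<b} = {x\<in>{a<..<b}. t < w x}" by auto
        also have "weight w \<dots> \<le> weight w ({a<..<b} \<inter> superlevel ?N t)"
          using t abc by (intro weight_large_values_le) auto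
        also have "\<dots> \<le> weight w (\<Omega> t)"
          unfolding \<Omega>_def using N.superlevel_subset_left_superlevel[of t b] by (intro weight_mono) auto
        also have "\<dots> = ennreal t * u t" unfolding u_def using est(2)[OF t] .
        finally have "?f t * emeasure ?D {x. (x, t) \<in> ?Q} \<le> ennreal (\<epsilon> * t powr (\<epsilon> - 1)) * (ennreal t * u t)"
          using True by (auto intro: mult_left_mono)
        also have "\<dots> = ennreal (\<epsilon> * t powr (\<epsilon> - 1) * t) * u t"
          using t \<epsilon> by (subst ennreal_mult) (auto simp: mult.assoc)
        also have "\<epsilon> * t powr (\<epsilon> - 1) * t = \<epsilon> * t powr \<epsilon>" using t by (simp add: powr_diff)
        also have "ennreal (\<epsilon> * t powr \<epsilon>) * u t = ennreal \<epsilon> * (ennreal (t powr \<epsilon>) * u t * indicator {l<..} t)"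
          using True \<epsilon> by (simp add: ennreal_mult mult.assoc)
        finally show ?thesis .
      qed simp
    qed
    also have "\<dots> = ennreal \<epsilon> * (\<integral>\<^sup>+t\<in>{l<..}. ennreal (t powr \<epsilon>) * u t \<partial>lborel)"
    proof (rule nn_integral_cmult)
      have [measurable]: "u \<in> borel_measurable borel" using u_meas by simp
      show "(\<lambda>t. ennreal (t powr \<epsilon>) * u t * indicator {l<..} t) \<in> borel_measurable lborel" by simp
    qed
    also have "\<dots> \<le> ennreal (l powr (1 + \<epsilon>)) * u l" by (rule powr_bound)
    also have "\<dots> = ennreal (l powr \<epsilon>) * (ennreal l * u l)"
      using l by (simp add: powr_add ennreal_mult mult_ac)
    also have "ennreal l * u l = weight w (\<Omega> l)" unfolding u_def using est(2)[OF l] by simp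
    also have "\<dots> \<le> ennreal V" using weight_mono[OF est(1)[OF l]] V by simp
    finally have "(\<integral>\<^sup>+t\<in>{a<..<b}. ennreal (w t powr (1 + \<epsilon>)) \<partial>lebesgue) \<le> ennreal (l powr \<epsilon>) * ennreal V + ennreal (l powr \<epsilon>) * ennreal V"
      by (simp add: add_left_mono add_right_mono mult_left_mono)
    also have "\<dots> = 2 * ennreal (l powr \<epsilon> * V)" using V(2) by (simp add: mult_2 ennreal_mult)
    finally have "ennreal ((c - b) powr \<epsilon>) * (\<integral>\<^sup>+t\<in>{a<..<b}. ennreal (w t powr (1 + \<epsilon>)) \<partial>lebesgue)
      \<le> ennreal ((c - b) powr \<epsilon>) * (2 * ennreal (l powr \<epsilon> * V))" by (rule mult_left_mono) simp
    also have "\<dots> = 2 * ennreal ((c - b) powr \<epsilon> * (l powr \<epsilon> * V))"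
      using V(2) by (subst ennreal_mult[of "(c - b) powr \<epsilon>"]) (auto simp: mult_ac)
    also have "(c - b) powr \<epsilon> * (l powr \<epsilon> * V) = V powr (1 + \<epsilon>)"
      using V(2) abc by (simp add: l_def powr_divide powr_add)
    finally show ?thesis by (simp add: V_def)
  qed
qed

end

section \<open>From the reverse Hoelder inequality to the bound for the weight of a set, and back\<close>

context weight_function begin

text \<open>
  Hoelder's inequality for \<open>w \<cdot> 1\<close> on \<open>E\<close>, with \<open>P\<close> any upper bound for the integral of \<open>w\<^sup>1\<^sup>+\<^sup>\<epsilon>\<close>.
\<close>

lemma weight_Hoelder:
  assumes E: "E \<in> sets lebesgue" "emeasure lebesgue E = ennreal m" "m \<ge> 0" and \<epsilon>: "\<epsilon> > 0" and P: "P > 0"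
    and int: "(\<integral>\<^sup>+t\<in>E. ennreal (w t powr (1 + \<epsilon>)) \<partial>lebesgue) \<le> ennreal P"
  shows "weight w E \<le> ennreal (P powr (1 / (1 + \<epsilon>)) * m powr (\<epsilon> / (1 + \<epsilon>)))"
proof (cases "m = 0")
  case True
  then have "E \<in> null_sets lebesgue" using E by auto
  then show ?thesis unfolding weight_def by (simp add: nn_integral_null_set)
next
  case False
  with E have m: "m > 0" by simp
  define p q where "p = 1 + \<epsilon>" and "q = (1 + \<epsilon>) / \<epsilon>"
  have pq: "p > 1" "q > 1" "1 / p + 1 / q = 1" using \<epsilon> by (auto simp: p_def q_def field_simps)
  \<comment> \<open>the scaling for which both terms of the Young inequality have the same integral up to the factors \<open>1 / p\<close> and \<open>1 / q\<close>\<close>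
  define k where "k = (m / P) powr (1 / (p * q))"
  have k: "k > 0" using m P by (simp add: k_def)
  have young: "w x \<le> k powr p / p * w x powr p + (1 / k) powr q / q" for x
    using Youngs_inequality[of p q "k * w x" "1 / k"] pq k nonneg[of x] by (simp add: powr_mult)
  have kp: "k powr p = (m / P) powr (1 / q)" and kq: "(1 / k) powr q = (m / P) powr (- (1 / p))"
    using pq k m P by (simp_all add: k_def powr_powr powr_minus powr_divide inverse_eq_divide)
  have "weight w E \<le> (\<integral>\<^sup>+t. ennreal (k powr p / p) * (ennreal (w t powr p) * indicator E t) + ennreal ((1 / k) powr q / q) * indicator E t \<partial>lebesgue)"
    unfolding weight_def
  proof (rule nn_integral_mono)
    fix t
    have "ennreal (w t) \<le> ennreal (k powr p / p) * ennreal (w t powr p) + ennreal ((1 / k) powr q / q)"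
      using young[of t] pq by (simp flip: ennreal_mult ennreal_plus add: ennreal_leI)
    then show "ennreal (w t) * indicator E t \<le> ennreal (k powr p / p) * (ennreal (w t powr p) * indicator E t) + ennreal ((1 / k) powr q / q) * indicator E t"
      by (auto split: split_indicator)
  qed
  also have "\<dots> = ennreal (k powr p / p) * (\<integral>\<^sup>+t\<in>E. ennreal (w t powr p) \<partial>lebesgue) + ennreal ((1 / k) powr q / q) * ennreal m"
  proof -
    have meas: "(\<lambda>t. ennreal (w t powr p) * indicator E t) \<in> borel_measurable lebesgue"
      using w_measurable E(1) by measurable
    then have "(\<integral>\<^sup>+t. ennreal (k powr p / p) * (ennreal (w t powr p) * indicator E t) + ennreal ((1 / k) powr q / q) * indicator E t \<partial>lebesgue)
      = (\<integral>\<^sup>+t. ennreal (k powr p / p) * (ennreal (w t powr p) * indicator E t) \<partial>lebesgue) + (\<integral>\<^sup>+t. ennreal ((1 / k) powr q / q) * indicator E t \<partial>lebesgue)"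
      by (intro nn_integral_add borel_measurable_times_ennreal meas borel_measurable_const
          borel_measurable_indicator E(1))
    then show ?thesis using meas E by (simp add: nn_integral_cmult nn_integral_cmult_indicator)
  qed
  also have "\<dots> \<le> ennreal (k powr p / p) * ennreal P + ennreal ((1 / k) powr q / q) * ennreal m"
    using int by (intro add_right_mono mult_left_mono) (auto simp: p_def)
  also have "\<dots> = ennreal (k powr p / p * P + (1 / k) powr q / q * m)"
    using pq P m by (simp flip: ennreal_mult ennreal_plus)
  also have "k powr p / p * P + (1 / k) powr q / q * m = P powr (1 / (1 + \<epsilon>)) * m powr (\<epsilon> / (1 + \<epsilon>))"
  proof -
    have *: "1 / q = 1 - 1 / p" "1 / p = 1 - 1 / q" using pq by auto
    have "k powr p * P = m powr (1 / q) * P powr (1 / p)"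
      unfolding kp using m P by (subst *(2)) (simp add: powr_divide powr_diff)
    moreover have "(1 / k) powr q * m = m powr (1 / q) * P powr (1 / p)"
      unfolding kq using m P by (subst *(1)) (simp add: powr_divide powr_diff powr_minus field_simps)
    ultimately have "k powr p / p * P + (1 / k) powr q / q * m = m powr (1 / q) * P powr (1 / p) * (1 / p + 1 / q)"
      by (simp add: field_simps)
    also have "\<dots> = P powr (1 / (1 + \<epsilon>)) * m powr (\<epsilon> / (1 + \<epsilon>))"
      unfolding pq(3) by (simp add: p_def q_def)
    finally show ?thesis .
  qed
  finally show ?thesis .
qed

lemma reverse_Hoelder_imp_weight_bound:
  assumes RH: "one_sided_reverse_Hoelder w \<epsilon>" and \<epsilon>: "\<epsilon> > 0"
  shows "one_sided_weight_bound w (\<epsilon> / (1 + \<epsilon>))"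
  unfolding one_sided_weight_bound_def
proof (intro allI impI, elim conjE)
  fix a b c :: real and E
  assume abc: "a < b" "b < c" and E: "E \<in> sets lebesgue" "E \<subseteq> {a<..<b}"
  define V where "V = enn2real (weight w {a<..<c})"
  have V: "weight w {a<..<c} = ennreal V" "V \<ge> 0"
    using weight_finite[of "{a<..<c}"] by (simp_all add: V_def less_top)
  have EV: "weight w E \<le> weight w {a<..<c}" using E abc by (intro weight_mono) auto
  have bE: "E \<in> lmeasurable" using E bounded_subset[OF bounded_Ioo E(2)] by (intro bounded_set_imp_lmeasurable) auto
  define m where "m = measure lebesgue E"
  have m: "emeasure lebesgue E = ennreal m" "m \<ge> 0"
    using bE by (auto simp: m_def emeasure_eq_measure2)
  have len: "measure lebesgue {b<..<c} = c - b" using abc by simp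
  show "weight w E / weight w {a<..<c} \<le> ennreal (2 * (measure lebesgue E / measure lebesgue {b<..<c}) powr (\<epsilon> / (1 + \<epsilon>)))"
  proof (cases "V = 0")
    case True
    then show ?thesis using EV V by simp
  next
    case False
    with V have Vp: "V > 0" by simp
    define P where "P = 2 * V powr (1 + \<epsilon>) / (c - b) powr \<epsilon>"
    have P: "P > 0" using Vp abc by (simp add: P_def)
    have "(\<integral>\<^sup>+t\<in>E. ennreal (w t powr (1 + \<epsilon>)) \<partial>lebesgue) \<le> (\<integral>\<^sup>+t\<in>{a<..<b}. ennreal (w t powr (1 + \<epsilon>)) \<partial>lebesgue)"
      using E by (intro nn_integral_mono) (auto split: split_indicator)
    also have "\<dots> \<le> ennreal P"
    proof -
      have "ennreal ((c - b) powr \<epsilon>) * (\<integral>\<^sup>+t\<in>{a<..<b}. ennreal (w t powr (1 + \<epsilon>)) \<partial>lebesgue) \<le> 2 * ennreal (V powr (1 + \<epsilon>))"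
        using RH abc unfolding one_sided_reverse_Hoelder_def V_def by (auto simp: len)
      also have "\<dots> = ennreal ((c - b) powr \<epsilon>) * ennreal P"
        using abc Vp by (simp add: P_def flip: ennreal_mult ennreal_numeral)
      finally show ?thesis using abc by (simp add: ennreal_mult_le_mult_iff)
    qed
    finally have "weight w E \<le> ennreal (P powr (1 / (1 + \<epsilon>)) * m powr (\<epsilon> / (1 + \<epsilon>)))"
      by (rule weight_Hoelder[OF E(1) m \<epsilon> P])
    also have "P powr (1 / (1 + \<epsilon>)) * m powr (\<epsilon> / (1 + \<epsilon>)) = 2 powr (1 / (1 + \<epsilon>)) * V * (m / (c - b)) powr (\<epsilon> / (1 + \<epsilon>))"
      using Vp abc m \<epsilon> by (simp add: P_def powr_divide powr_mult powr_powr)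
    also have "\<dots> \<le> 2 * V * (m / (c - b)) powr (\<epsilon> / (1 + \<epsilon>))"
      using Vp \<epsilon> powr_mono[of "1 / (1 + \<epsilon>)" 1 2] by (intro mult_right_mono) auto
    finally have "weight w E \<le> ennreal (2 * (m / (c - b)) powr (\<epsilon> / (1 + \<epsilon>)) * V)"
      by (simp add: mult_ac ennreal_leI)
    then have "weight w E / ennreal V \<le> ennreal (2 * (m / (c - b)) powr (\<epsilon> / (1 + \<epsilon>)) * V) / ennreal V"
      by (rule divide_right_mono_ennreal)
    also have "\<dots> = ennreal (2 * (m / (c - b)) powr (\<epsilon> / (1 + \<epsilon>)))"
      using Vp by (subst divide_ennreal) auto
    finally show ?thesis by (simp only: len V(1) m_def)
  qed
qed

lemma one_sided_weight_boundD:
  assumes "one_sided_weight_bound w \<delta>" "a < b" "b < c" "E \<in> sets lebesgue" "E \<subseteq> {a<..<b}"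
  shows "weight w E \<le> ennreal (2 * (measure lebesgue E / (c - b)) powr \<delta>) * weight w {a<..<c}"
proof (cases "weight w {a<..<c} = 0")
  case True
  have "E \<subseteq> {a<..<c}" using assms by auto
  then have "weight w E \<le> weight w {a<..<c}" by (rule weight_mono)
  then show ?thesis using True by simp
next
  case False
  have "weight w E / weight w {a<..<c} \<le> ennreal (2 * (measure lebesgue E / (c - b)) powr \<delta>)"
    using assms unfolding one_sided_weight_bound_def by fastforce
  then have "weight w E / weight w {a<..<c} * weight w {a<..<c} \<le> ennreal (2 * (measure lebesgue E / (c - b)) powr \<delta>) * weight w {a<..<c}"
    by (rule mult_right_mono) simp
  moreover have "weight w E / weight w {a<..<c} * weight w {a<..<c} = weight w E"
    using False weight_finite[of "{a<..<c}"] by (simp add: ennreal_divide_times)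
  ultimately show ?thesis by simp
qed

text \<open>
  Integrate the measure of the superlevel sets \<open>S\<^sub>t\<close> over the levels \<open>t\<close>, with \<open>W = w(p, r)\<close>.
  Levels below \<open>l = W / (r - q)\<close> contribute at most \<open>l (q - p)\<close>.  For \<open>t > l\<close> the weak type inequality gives
  \<open>|S\<^sub>t| \<le> W / t\<close>; the hypothesis on \<open>w\<close> turns this into \<open>w(S\<^sub>t) \<le> 2 (l / t)\<^sup>\<delta> W\<close>, and a second use of the
  weak type inequality into a bound for \<open>|S\<^sub>t|\<close> that is integrable in \<open>t\<close>.
\<close>

lemma integral_backward_max_le_of_gap:
  assumes bd: "one_sided_weight_bound w \<delta>" and \<delta>: "\<delta> > 0" and pqr: "p < q" "q < r"
  shows "(\<integral>\<^sup>+x\<in>{p<..<q}. backward_max (restricted_weight w {p<..<q}) x \<partial>lebesgue)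
    \<le> ennreal ((q - p) / (r - q) + 2 / \<delta>) * weight w {p<..<r}"
proof -
  let ?N = "restricted_weight w {p<..<q}"
  interpret N: continuous_finite_measure ?N by (rule continuous_restricted_weight)
  define W where "W = enn2real (weight w {p<..<r})"
  have W: "weight w {p<..<r} = ennreal W" "W \<ge> 0"
    using weight_finite[of "{p<..<r}"] by (simp_all add: W_def less_top)
  have NW: "weight w S \<le> ennreal W" if "S \<subseteq> {p<..<q}" for S
    unfolding W(1)[symmetric] using that pqr by (intro weight_mono) auto
  show ?thesis
  proof (cases "W = 0")
    case True
    have "backward_max ?N x = 0" for x
    proof -
      have "emeasure ?N {x - h..x} = 0" for h
        using NW[of "{x - h..x} \<inter> {p<..<q}"] True by (simp add: emeasure_restricted_weight)
      then show ?thesis unfolding backward_max_def by (simp add: SUP_constant)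
    qed
    then show ?thesis by simp
  next
    case False
    with W have Wp: "W > 0" by simp
    define l where "l = W / (r - q)"
    have l: "l > 0" using Wp pqr by (simp add: l_def)
    let ?Q = "{(x, t). x \<in> superlevel ?N t} \<inter> {p<..<q} \<times> UNIV"
    let ?f = "indicator {l<..} :: real \<Rightarrow> ennreal"
    have Q: "?Q \<in> sets (lebesgue \<Otimes>\<^sub>M lborel)"
      by (intro open_in_sets_pair_lborel open_Int N.open_superlevel_graph open_Times) auto
    have "(\<integral>\<^sup>+x\<in>{p<..<q}. backward_max ?N x \<partial>lebesgue)
      \<le> (\<integral>\<^sup>+x. ennreal l * indicator {p<..<q} x + (\<integral>\<^sup>+t. ?f t * indicator ?Q (x, t) \<partial>lborel) \<partial>lebesgue)"
    proof (rule nn_integral_mono)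
      fix x
      show "backward_max ?N x * indicator {p<..<q} x \<le> ennreal l * indicator {p<..<q} x + (\<integral>\<^sup>+t. ?f t * indicator ?Q (x, t) \<partial>lborel)"
      proof (cases "x \<in> {p<..<q}")
        case x: True
        show ?thesis
        proof (cases "backward_max ?N x")
          case (real m)
          have "ennreal (m - l) \<le> (\<integral>\<^sup>+t. ?f t * indicator ?Q (x, t) \<partial>lborel)"
          proof -
            have "ennreal (m - l) = (\<integral>\<^sup>+t. indicator {l<..<m} t \<partial>lborel)"
              by (cases "l \<le> m") (auto simp: ennreal_neg)
            also have "\<dots> \<le> (\<integral>\<^sup>+t. ?f t * indicator ?Q (x, t) \<partial>lborel)"
              using x l real N.less_backward_max_iff[of _ x]
              by (intro nn_integral_mono) (auto split: split_indicator simp: ennreal_less_iff)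
            finally show ?thesis .
          qed
          then have mid: "ennreal l + ennreal (m - l) \<le> ennreal l + (\<integral>\<^sup>+t. ?f t * indicator ?Q (x, t) \<partial>lborel)"
            by (rule add_left_mono)
          have "ennreal m \<le> ennreal l + ennreal (m - l)"
            using l real(1) by (cases "l \<le> m") (auto simp: ennreal_neg simp flip: ennreal_plus)
          from order_trans[OF this mid] show ?thesis using x real by simp
        next
          case top
          have "\<infinity> = (\<integral>\<^sup>+t. indicator {l<..} t \<partial>lborel)"
          proof -
            have large: "ennreal n \<le> emeasure lborel {l<..}" if "n \<ge> 0" for n
            proof -
              have "ennreal n = emeasure lborel {l<..<l + n}" using that by simp
              also have "\<dots> \<le> emeasure lborel {l<..}" by (intro emeasure_mono) auto
              finally show ?thesis .
            qed
            have "emeasure lborel {l<..} = \<infinity>"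
            proof (cases "emeasure lborel {l<..}")
              case (real r)
              with large[of "r + 1"] show ?thesis by (simp del: ennreal_plus)
            qed simp
            then show ?thesis by simp
          qed
          also have "\<dots> \<le> (\<integral>\<^sup>+t. ?f t * indicator ?Q (x, t) \<partial>lborel)"
            using x l top N.less_backward_max_iff[of _ x]
            by (intro nn_integral_mono) (auto split: split_indicator)
          finally show ?thesis by (simp add: top_unique)
        qed
      qed simp
    qed
    also have "\<dots> = ennreal l * ennreal (q - p) + (\<integral>\<^sup>+x. (\<integral>\<^sup>+t. ?f t * indicator ?Q (x, t) \<partial>lborel) \<partial>lebesgue)"
    proof -
      have "(\<lambda>x. \<integral>\<^sup>+t. ?f t * indicator ?Q (x, t) \<partial>lborel) \<in> borel_measurable lebesgue"
        using Q by measurable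
      moreover have "(\<lambda>x. ennreal l * indicator {p<..<q} x) \<in> borel_measurable lebesgue"
        by (intro borel_measurable_times_ennreal borel_measurable_const borel_measurable_indicator) auto
      ultimately show ?thesis using pqr by (simp add: nn_integral_add nn_integral_cmult_indicator)
    qed
    also have "(\<integral>\<^sup>+x. (\<integral>\<^sup>+t. ?f t * indicator ?Q (x, t) \<partial>lborel) \<partial>lebesgue) = (\<integral>\<^sup>+t. ?f t * emeasure lebesgue {x. (x, t) \<in> ?Q} \<partial>lborel)"
      by (rule nn_integral_layers[OF sigma_finite_lebesgue _ Q]) simp
    also have "\<dots> \<le> (\<integral>\<^sup>+t. ennreal (2 * W * l powr \<delta>) * (ennreal (t powr (- \<delta> - 1)) * indicator {l<..} t) \<partial>lborel)"
    proof (rule nn_integral_mono)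
      fix t
      show "?f t * emeasure lebesgue {x. (x, t) \<in> ?Q} \<le> ennreal (2 * W * l powr \<delta>) * (ennreal (t powr (- \<delta> - 1)) * indicator {l<..} t)"
      proof (cases "l < t")
        case True
        let ?E = "superlevel ?N t \<inter> {p<..<q}"
        have E: "?E \<in> sets lebesgue" using N.open_superlevel by auto
        have Em: "?E \<in> lmeasurable"
          using bounded_subset[OF bounded_Ioo[of p q], of ?E] E by (intro bounded_set_imp_lmeasurable) auto
        define u where "u = measure lebesgue ?E"
        have u: "emeasure lebesgue ?E = ennreal u" "u \<ge> 0" using Em by (auto simp: u_def emeasure_eq_measure2)
        have wt: "ennreal t * ennreal u \<le> weight w ?E"
          using N.weak_type_superlevel[of t p q] True l restricted_weight_null_outside(1)[of p q] E u
          by (simp add: emeasure_restricted_weight)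
        also have "\<dots> \<le> ennreal W" by (rule NW) auto
        finally have tu: "t * u \<le> W" using True l u Wp by (simp flip: ennreal_mult)
        then have "u \<le> W / t" using True l by (simp add: field_simps)
        then have "u / (r - q) \<le> W / t / (r - q)" using pqr by (intro divide_right_mono) auto
        then have "u / (r - q) \<le> l / t" by (simp add: l_def mult.commute)
        then have "(u / (r - q)) powr \<delta> \<le> (l / t) powr \<delta>" using u pqr \<delta> by (intro powr_mono2) auto
        moreover have "t * u \<le> 2 * (u / (r - q)) powr \<delta> * W"
        proof -
          have "ennreal (t * u) \<le> ennreal (2 * (u / (r - q)) powr \<delta> * W)"
            using order_trans[OF wt one_sided_weight_boundD[OF bd pqr E, folded u_def]] True l u W
            by (simp flip: ennreal_mult)
          then show ?thesis using W by simp
        qed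
        ultimately have "t * u \<le> 2 * (l / t) powr \<delta> * W"
          using W by (smt (verit) mult_right_mono mult_left_mono)
        then have "u \<le> 2 * W * l powr \<delta> * t powr (- \<delta> - 1)"
          using True l by (simp add: powr_divide powr_diff powr_minus field_simps)
        then have "ennreal u \<le> ennreal (2 * W * l powr \<delta>) * ennreal (t powr (- \<delta> - 1))"
          using W by (subst ennreal_mult[symmetric]) (auto intro: ennreal_leI)
        moreover have "{x. (x, t) \<in> ?Q} = ?E" by auto
        ultimately show ?thesis using True u by simp
      qed simp
    qed
    also have "\<dots> = ennreal (2 * W * l powr \<delta>) * ennreal (l powr (- \<delta>) / \<delta>)"
      using nn_integral_powr_tail[OF l \<delta>] by (subst nn_integral_cmult) auto
    also have "\<dots> = ennreal (2 * W / \<delta>)"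
      using W l \<delta> by (simp add: powr_minus flip: ennreal_mult)
    finally have "(\<integral>\<^sup>+x\<in>{p<..<q}. backward_max ?N x \<partial>lebesgue) \<le> ennreal l * ennreal (q - p) + ennreal (2 * W / \<delta>)"
      by (simp add: add_left_mono)
    also have "\<dots> = ennreal (((q - p) / (r - q) + 2 / \<delta>) * W)"
      using l W pqr \<delta> by (simp add: l_def distrib_left mult.commute flip: ennreal_mult ennreal_plus)
    also have "\<dots> = ennreal ((q - p) / (r - q) + 2 / \<delta>) * weight w {p<..<r}"
      unfolding W(1) using W(2) pqr \<delta> by (intro ennreal_mult) auto
    finally show ?thesis .
  qed
qed

text \<open>
  By Tonelli: a point mass at \<open>t\<close> contributes \<open>2 / (b - t)\<close> on an interval of length \<open>b - t\<close>.
\<close>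

lemma restricted_weight_far_integral:
  assumes "a < b"
  shows "(\<integral>\<^sup>+x\<in>{a<..<b}. (\<integral>\<^sup>+t. ennreal (2 / (b - t)) * indicator {..<x} t \<partial>restricted_weight w {a<..<b}) \<partial>lborel)
    = 2 * weight w {a<..<b}"
    (is "?L = _")
proof -
  let ?D = "restricted_weight w {a<..<b}"
  interpret D: continuous_finite_measure ?D by (rule continuous_restricted_weight)
  interpret pair_sigma_finite ?D "lborel :: real measure"
    by (intro pair_sigma_finite.intro lborel.sigma_finite_measure_axioms D.sigma_finite_measure_axioms)
  have id[measurable]: "(\<lambda>x. x) \<in> ?D \<rightarrow>\<^sub>M borel"
    by (simp add: measurable_def restricted_weight_def)
  let ?k = "\<lambda>t x. if t < x \<and> a < x \<and> x < b then ennreal (2 / (b - t)) else 0"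
  have meas: "(\<lambda>(t, x). ?k t x) \<in> borel_measurable (?D \<Otimes>\<^sub>M lborel)"
    by measurable
  have "?L = (\<integral>\<^sup>+x. (\<integral>\<^sup>+t. ?k t x \<partial>?D) \<partial>lborel)"
  proof (rule nn_integral_cong)
    fix x
    show "(\<integral>\<^sup>+t. ennreal (2 / (b - t)) * indicator {..<x} t \<partial>?D) * indicator {a<..<b} x = (\<integral>\<^sup>+t. ?k t x \<partial>?D)"
    proof (cases "x \<in> {a<..<b}")
      case True
      then show ?thesis by (auto intro!: nn_integral_cong split: split_indicator)
    next
      case False
      then have "(\<integral>\<^sup>+t. ?k t x \<partial>?D) = (\<integral>\<^sup>+t. 0 \<partial>?D)" by (intro nn_integral_cong) auto
      with False show ?thesis by simp
    qed
  qed
  also have "\<dots> = (\<integral>\<^sup>+t. (\<integral>\<^sup>+x. ?k t x \<partial>lborel) \<partial>?D)"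
    using Fubini'[OF meas] by simp
  also have "\<dots> = (\<integral>\<^sup>+t. 2 \<partial>?D)"
  proof (rule nn_integral_cong_AE)
    have "AE t in ?D. t \<in> {a<..<b}"
    proof (rule AE_I)
      show "emeasure ?D (- {a<..<b}) = 0"
        by (subst emeasure_restricted_weight) (auto simp: weight_def)
    qed auto
    then show "AE t in ?D. (\<integral>\<^sup>+x. ?k t x \<partial>lborel) = 2"
    proof eventually_elim
      case (elim t)
      have "(\<integral>\<^sup>+x. ?k t x \<partial>lborel) = (\<integral>\<^sup>+x. ennreal (2 / (b - t)) * indicator {t<..<b} x \<partial>lborel)"
        using elim by (intro nn_integral_cong) (auto split: split_indicator)
      also have "\<dots> = ennreal (2 / (b - t)) * ennreal (b - t)"
        using elim by (subst nn_integral_cmult_indicator) auto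
      also have "\<dots> = ennreal (2 / (b - t) * (b - t))" using elim by (intro ennreal_mult[symmetric]) auto
      also have "2 / (b - t) * (b - t) = 2" using elim by (simp add: field_simps)
      finally show ?case by simp
    qed
  qed
  also have "\<dots> = 2 * weight w {a<..<b}"
  proof -
    have "space ?D = UNIV" by (simp add: restricted_weight_def)
    then show ?thesis by (simp add: emeasure_restricted_weight)
  qed
  finally show ?thesis .
qed

text \<open>
  Split every average at \<open>g\<close>; if \<open>g = a\<close> there is no mass to the left of \<open>g\<close>.  Otherwise a point \<open>t \<le> g\<close> is so far from \<open>x\<close> that
  \<open>b - t \<le> 2 (x - t) \<le> 2 h\<close>; the factor \<open>1 / h\<close> may thus be replaced by the kernel \<open>2 / (b - t)\<close>, which
  depends on neither \<open>x\<close> nor \<open>h\<close>.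
\<close>

lemma backward_max_le_far_plus_local:
  assumes x: "a \<le> g" "g \<le> x" "x < d" "d \<le> b" and far: "g = a \<or> g + b \<le> 2 * x"
  shows "backward_max (restricted_weight w {a<..<b}) x
    \<le> (\<integral>\<^sup>+t. ennreal (2 / (b - t)) * indicator {..<x} t \<partial>restricted_weight w {a<..<b})
      + backward_max (restricted_weight w {g<..<d}) x"
  unfolding backward_max_def[of "restricted_weight w {a<..<b}"]
proof (rule SUP_least)
  let ?D = "restricted_weight w {a<..<b}" and ?N = "restricted_weight w {g<..<d}"
  fix h :: real assume "h \<in> {0<..}"
  then have h: "h > 0" by simp
  let ?far = "\<integral>\<^sup>+t. ennreal (2 / (b - t)) * indicator {..<x} t \<partial>?D"
  have far_part: "1 / ennreal h * emeasure ?D ({x - h..x} \<inter> {a<..g}) \<le> ?far"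
  proof -
    have "1 / ennreal h * emeasure ?D ({x - h..x} \<inter> {a<..g}) = (\<integral>\<^sup>+t. 1 / ennreal h * indicator ({x - h..x} \<inter> {a<..g}) t \<partial>?D)"
      by (subst nn_integral_cmult_indicator) auto
    also have "\<dots> = (\<integral>\<^sup>+t. ennreal (1 / h) * indicator ({x - h..x} \<inter> {a<..g}) t \<partial>?D)"
      using h by (simp add: divide_ennreal flip: ennreal_1)
    also have "\<dots> \<le> ?far"
    proof (rule nn_integral_mono)
      fix t
      show "ennreal (1 / h) * indicator ({x - h..x} \<inter> {a<..g}) t \<le> ennreal (2 / (b - t)) * indicator {..<x} t"
      proof (cases "t \<in> {x - h..x} \<inter> {a<..g}")
        case True
        then have t: "x - h \<le> t" "a < t" "t \<le> g" by auto
        have "b - t \<le> 2 * (x - t)" "g \<noteq> a" using far t by auto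
        then have "t < x" "b - t \<le> 2 * h" using x t by auto
        moreover from this have "1 / h \<le> 2 / (b - t)" using h x by (simp add: field_simps)
        ultimately show ?thesis by (simp add: ennreal_leI indicator_def)
      qed simp
    qed
    finally show ?thesis .
  qed
  have local_part: "1 / ennreal h * emeasure ?N {x - h..x} \<le> backward_max ?N x"
    unfolding backward_max_def using h by (intro SUP_upper) auto
  have "emeasure ?D {x - h..x} \<le> emeasure ?D ({x - h..x} \<inter> {a<..g}) + emeasure ?N {x - h..x}"
  proof -
    have "emeasure ?D {x - h..x} = emeasure ?D ({x - h..x} \<inter> {a<..<b})"
      by (simp add: emeasure_restricted_weight Int_assoc)
    also have "\<dots> \<le> emeasure ?D ({x - h..x} \<inter> {a<..g} \<union> {x - h..x} \<inter> {g<..<d})"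
      using x by (intro emeasure_mono) auto
    also have "\<dots> \<le> emeasure ?D ({x - h..x} \<inter> {a<..g}) + emeasure ?D ({x - h..x} \<inter> {g<..<d})"
      by (intro emeasure_subadditive) auto
    also have "emeasure ?D ({x - h..x} \<inter> {g<..<d}) = emeasure ?N {x - h..x}"
    proof -
      have "{x - h..x} \<inter> {g<..<d} \<inter> {a<..<b} = {x - h..x} \<inter> {g<..<d}" using x by auto
      then show ?thesis by (simp add: emeasure_restricted_weight)
    qed
    finally show ?thesis .
  qed
  then have "1 / ennreal h * emeasure ?D {x - h..x}
      \<le> 1 / ennreal h * (emeasure ?D ({x - h..x} \<inter> {a<..g}) + emeasure ?N {x - h..x})"
    by (rule mult_left_mono) simp
  also have "\<dots> \<le> ?far + backward_max ?N x"
    unfolding distrib_left by (rule add_mono[OF far_part local_part])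
  finally show "1 / ennreal h * emeasure ?D {x - h..x} \<le> ?far + backward_max ?N x" .
qed

text \<open>
  For \<open>k + i = 0\<close> truncated subtraction makes the interval empty.
\<close>

lemma suminf_weight_shift_le:
  fixes y :: "nat \<Rightarrow> real"
  assumes "mono y" "\<And>k. a \<le> y k" "\<And>k. y k < b"
  shows "(\<Sum>k. weight w {y (k + i - 1)<..y (k + i)}) \<le> weight w {a<..<b}"
proof -
  let ?W = "density lebesgue (\<lambda>t. ennreal (w t))"
  have disj: "{y (m + i - 1)<..y (m + i)} \<inter> {y (n + i - 1)<..y (n + i)} = {}" if "m < n" for m n
  proof -
    have "y (m + i) \<le> y (n + i - 1)" using that by (intro monoD[OF assms(1)]) auto
    then show ?thesis by auto
  qed
  have "disjoint_family (\<lambda>k. {y (k + i - 1)<..y (k + i)})"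
    unfolding disjoint_family_on_def using disj by (metis Int_commute linorder_neqE_nat)
  then have "(\<Sum>k. emeasure ?W {y (k + i - 1)<..y (k + i)}) = emeasure ?W (\<Union>k. {y (k + i - 1)<..y (k + i)})"
    by (intro suminf_emeasure) auto
  also have "\<dots> = weight w (\<Union>k. {y (k + i - 1)<..y (k + i)})"
    by (intro emeasure_density_weight) auto
  also have "\<dots> \<le> weight w {a<..<b}"
  proof (rule weight_mono)
    have "{y (k + i - 1)<..y (k + i)} \<subseteq> {a<..<b}" for k
      using assms(2)[of "k + i - 1"] assms(3)[of "k + i"] by auto
    then show "(\<Union>k. {y (k + i - 1)<..y (k + i)}) \<subseteq> {a<..<b}" by (rule UN_least)
  qed
  finally show ?thesis by (simp add: emeasure_density_weight)
qed

text \<open>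
  The hypothesis only speaks about intervals with a gap to their right, so \<open>(a, b)\<close> is cut at the points
  \<open>y k = b - (b - a) / 2\<^sup>k\<close>.  On \<open>(y k, y (k + 1))\<close> the mass to the left of \<open>y (k - 1)\<close> is dealt with by the far
  kernel, whose total contribution is \<open>2 w(a, b)\<close>.  The local part is estimated on \<open>(y (k - 1), y (k + 1))\<close> with
  the gap \<open>(y (k + 1), y (k + 2))\<close>, which is at most 6 times shorter; the intervals
  \<open>(y (k - 1), y (k + 2))\<close> that carry the bound overlap at most three times.
\<close>

lemma integral_backward_max_le_of_weight_bound:
  assumes bd: "one_sided_weight_bound w \<delta>" and \<delta>: "\<delta> > 0" and ab: "a < b"
  shows "(\<integral>\<^sup>+x\<in>{a<..<b}. backward_max (restricted_weight w {a<..<b}) x \<partial>lebesgue)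
    \<le> ennreal (20 + 6 / \<delta>) * weight w {a<..<b}"
proof -
  let ?D = "restricted_weight w {a<..<b}"
  interpret D: continuous_finite_measure ?D by (rule continuous_restricted_weight)
  define y where "y k = b - (b - a) / 2 ^ k" for k :: nat
  define N where "N k = restricted_weight w {y (k - 1)<..<y (k + 1)}" for k
  define far where "far x = (\<integral>\<^sup>+t. ennreal (2 / (b - t)) * indicator {..<x} t \<partial>?D)" for x
  have y_step: "y (k + 1) - y k = (b - a) / 2 ^ k / 2" for k by (simp add: y_def field_simps)
  have y_mono: "mono y" unfolding y_def using ab by (intro monoI diff_left_mono divide_left_mono power_increasing) auto
  have y_less: "y k < y (k + 1)" "y k < b" "a \<le> y k" for k
  proof -
    show "y k < y (k + 1)" using y_step[of k] ab by (smt (verit) divide_pos_pos zero_less_power)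
    show "y k < b" using ab by (simp add: y_def)
    show "a \<le> y k" using monoD[OF y_mono, of 0 k] by (simp add: y_def)
  qed
  have y0: "y 0 = a" by (simp add: y_def)
  have N_meas: "backward_max (N k) \<in> borel_measurable lebesgue" for k
    unfolding N_def by (rule continuous_finite_measure.backward_max_measurable[OF continuous_restricted_weight])
  have local: "backward_max ?D x \<le> far x + backward_max (N k) x" if "y k < x" "x < y (k + 1)" for k x
    unfolding far_def N_def
  proof (rule backward_max_le_far_plus_local)
    show "a \<le> y (k - 1)" "x < y (k + 1)" "y (k + 1) \<le> b" using y_less that by (auto intro: less_imp_le)
    show "y (k - 1) \<le> x" using monoD[OF y_mono, of "k - 1" k] that by simp
    show "y (k - 1) = a \<or> y (k - 1) + b \<le> 2 * x"
    proof (cases k)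
      case (Suc j)
      have "y j + b = 2 * y k" by (simp add: y_def Suc field_simps)
      then show ?thesis using that Suc by auto
    qed (simp add: y0)
  qed
  have split: "backward_max ?D x * indicator {a<..<b} x
      \<le> far x * indicator {a<..<b} x + (\<Sum>k. backward_max (N k) x * indicator {y k<..<y (k + 1)} x)"
    if x: "x \<notin> range y" for x
  proof (cases "x \<in> {a<..<b}")
    case True
    have "\<exists>n. x < y n"
    proof -
      have "(\<lambda>n. b - (b - a) / 2 ^ n) \<longlonglongrightarrow> b - 0"
        by (intro tendsto_diff tendsto_const LIMSEQ_divide_realpow_zero) auto
      then have "eventually (\<lambda>n. x < y n) sequentially"
        unfolding y_def using True by (intro order_tendstoD) auto
      then show ?thesis by (auto simp: eventually_sequentially)
    qed
    then have least: "x < y (LEAST n. x < y n)" by (rule LeastI_ex)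
    define n where "n = (LEAST n. x < y n)"
    have n: "x < y n" unfolding n_def by (rule least)
    have n_least: "\<not> x < y m" if "m < n" for m
      using that unfolding n_def by (rule not_less_Least)
    \<comment> \<open>\<open>x\<close> is beyond \<open>y 0 = a\<close>, so the first \<open>y n\<close> beyond \<open>x\<close> has a predecessor\<close>
    have "n \<noteq> 0" using n True y0 by (metis greaterThanLessThan_iff less_asym)
    then obtain k where k: "n = k + 1" by (metis Suc_eq_plus1 not0_implies_Suc)
    have "y k \<noteq> x" using x by auto
    then have xk: "y k < x" "x < y (k + 1)" using n n_least[of k] k by auto
    define T where "T j = backward_max (N j) x * indicator {y j<..<y (j + 1)} x" for j
    have "backward_max (N k) x = T k" using xk by (simp add: T_def)
    also have "\<dots> \<le> (\<Sum>k. T k)" using sum_le_suminf[of T "{k}"] by simp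
    finally have "backward_max (N k) x \<le> (\<Sum>k. backward_max (N k) x * indicator {y k<..<y (k + 1)} x)"
      unfolding T_def .
    then have "far x + backward_max (N k) x \<le> far x + (\<Sum>k. backward_max (N k) x * indicator {y k<..<y (k + 1)} x)"
      by (rule add_left_mono)
    from order_trans[OF local[OF xk] this] show ?thesis using True by simp
  qed simp
  have step: "(\<integral>\<^sup>+x\<in>{y k<..<y (k + 1)}. backward_max (N k) x \<partial>lebesgue)
      \<le> ennreal (6 + 2 / \<delta>) * (weight w {y (k + 0 - 1)<..y (k + 0)} + weight w {y (k + 1 - 1)<..y (k + 1)} + weight w {y (k + 2 - 1)<..y (k + 2)})" for k
  proof -
    have le: "y (k - 1) \<le> y k" by (rule monoD[OF y_mono]) simp
    have "(\<integral>\<^sup>+x\<in>{y k<..<y (k + 1)}. backward_max (N k) x \<partial>lebesgue)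
        \<le> (\<integral>\<^sup>+x\<in>{y (k - 1)<..<y (k + 1)}. backward_max (N k) x \<partial>lebesgue)"
      using le by (intro nn_integral_mono) (auto split: split_indicator)
    also have "\<dots> \<le> ennreal ((y (k + 1) - y (k - 1)) / (y (k + 2) - y (k + 1)) + 2 / \<delta>) * weight w {y (k - 1)<..<y (k + 2)}"
      unfolding N_def using le y_less[of k] y_less[of "k + 1"]
      by (intro integral_backward_max_le_of_gap[OF bd \<delta>]) auto
    also have "\<dots> \<le> ennreal (6 + 2 / \<delta>) * weight w {y (k - 1)<..<y (k + 2)}"
    proof (intro mult_right_mono ennreal_leI add_right_mono)
      define L where "L = (b - a) / 2 ^ k"
      have "L > 0" using ab by (simp add: L_def)
      moreover have gap: "y (k + 2) - y (k + 1) = L / 4" by (simp add: y_def L_def field_simps)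
      moreover have "y (k + 1) - y (k - 1) \<le> L * (3 / 2)"
        using ab by (cases k) (simp_all add: y_def L_def field_simps)
      ultimately show "(y (k + 1) - y (k - 1)) / (y (k + 2) - y (k + 1)) \<le> 6"
        unfolding gap by (simp add: field_simps)
    qed simp
    also have "weight w {y (k - 1)<..<y (k + 2)} \<le>
      weight w {y (k + 0 - 1)<..y (k + 0)} + weight w {y (k + 1 - 1)<..y (k + 1)} + weight w {y (k + 2 - 1)<..y (k + 2)}"
    proof -
      let ?W = "density lebesgue (\<lambda>t. ennreal (w t))"
      let ?A = "{y (k - 1)<..y k}" and ?B = "{y k<..y (k + 1)}" and ?C = "{y (k + 1)<..y (k + 2)}"
      \<comment> \<open>a cover, with \<open>?A\<close> empty if \<open>k = 0\<close>\<close>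
      have "weight w {y (k - 1)<..<y (k + 2)} \<le> emeasure ?W (?A \<union> ?B \<union> ?C)"
        by (subst emeasure_density_weight) (auto intro!: weight_mono)
      also have "\<dots> \<le> emeasure ?W (?A \<union> ?B) + emeasure ?W ?C"
        by (intro emeasure_subadditive) auto
      also have "\<dots> \<le> emeasure ?W ?A + emeasure ?W ?B + emeasure ?W ?C"
        by (intro add_right_mono emeasure_subadditive) auto
      finally show ?thesis by (simp add: emeasure_density_weight)
    qed
    finally show ?thesis by (simp add: mult_left_mono)
  qed
  have "AE x in lebesgue. x \<notin> range y"
    by (intro AE_not_in null_sets_completionI countable_imp_null_set_lborel) auto
  then have "(\<integral>\<^sup>+x\<in>{a<..<b}. backward_max ?D x \<partial>lebesgue)
    \<le> (\<integral>\<^sup>+x. far x * indicator {a<..<b} x + (\<Sum>k. backward_max (N k) x * indicator {y k<..<y (k + 1)} x) \<partial>lebesgue)"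
    by (intro nn_integral_mono_AE) (rule eventually_mono[OF _ split])
  also have "\<dots> = (\<integral>\<^sup>+x\<in>{a<..<b}. far x \<partial>lebesgue) + (\<integral>\<^sup>+x. (\<Sum>k. backward_max (N k) x * indicator {y k<..<y (k + 1)} x) \<partial>lebesgue)"
  proof (rule nn_integral_add)
    have [measurable]: "(\<lambda>t. t) \<in> ?D \<rightarrow>\<^sub>M borel"
      by (simp add: measurable_def restricted_weight_def)
    have "far = (\<lambda>x. \<integral>\<^sup>+t. (if t < x then ennreal (2 / (b - t)) else 0) \<partial>?D)"
      unfolding far_def by (intro ext nn_integral_cong) simp
    also have "\<dots> \<in> borel_measurable borel" by measurable
    finally have "(\<lambda>x. far x * indicator {a<..<b} x) \<in> borel_measurable lborel" by simp
    then show "(\<lambda>x. far x * indicator {a<..<b} x) \<in> borel_measurable lebesgue" by (rule measurable_completion)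
    show "(\<lambda>x. \<Sum>k. backward_max (N k) x * indicator {y k<..<y (k + 1)} x) \<in> borel_measurable lebesgue"
      by (intro borel_measurable_suminf_order borel_measurable_times_ennreal N_meas borel_measurable_indicator) auto
  qed
  also have "(\<integral>\<^sup>+x\<in>{a<..<b}. far x \<partial>lebesgue) = 2 * weight w {a<..<b}"
    unfolding nn_integral_completion far_def by (rule restricted_weight_far_integral[OF ab])
  also have "(\<integral>\<^sup>+x. (\<Sum>k. backward_max (N k) x * indicator {y k<..<y (k + 1)} x) \<partial>lebesgue)
    = (\<Sum>k. \<integral>\<^sup>+x\<in>{y k<..<y (k + 1)}. backward_max (N k) x \<partial>lebesgue)"
    by (intro nn_integral_suminf borel_measurable_times_ennreal N_meas borel_measurable_indicator) auto
  also have "\<dots> \<le> (\<Sum>k. ennreal (6 + 2 / \<delta>) * (weight w {y (k + 0 - 1)<..y (k + 0)} + weight w {y (k + 1 - 1)<..y (k + 1)} + weight w {y (k + 2 - 1)<..y (k + 2)}))"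
    by (intro suminf_le step) auto
  also have "\<dots> = ennreal (6 + 2 / \<delta>) * ((\<Sum>k. weight w {y (k + 0 - 1)<..y (k + 0)}) + (\<Sum>k. weight w {y (k + 1 - 1)<..y (k + 1)}) + (\<Sum>k. weight w {y (k + 2 - 1)<..y (k + 2)}))"
    by (simp only: ennreal_suminf_cmult suminf_add[OF summableI summableI, symmetric])
  also have "\<dots> \<le> ennreal (6 + 2 / \<delta>) * (weight w {a<..<b} + weight w {a<..<b} + weight w {a<..<b})"
    using y_less by (intro mult_left_mono add_mono suminf_weight_shift_le[OF y_mono]) auto
  also have "\<dots> = ennreal (18 + 6 / \<delta>) * weight w {a<..<b}"
  proof -
    have "weight w {a<..<b} + weight w {a<..<b} + weight w {a<..<b} = ennreal 3 * weight w {a<..<b}"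
    proof -
      have "(1 + 1 + 1) * weight w {a<..<b} = weight w {a<..<b} + weight w {a<..<b} + weight w {a<..<b}"
        by (simp only: distrib_right mult_1)
      then show ?thesis by simp
    qed
    moreover have "ennreal (6 + 2 / \<delta>) * ennreal 3 = ennreal (18 + 6 / \<delta>)"
    proof -
      have "ennreal (6 + 2 / \<delta>) * ennreal 3 = ennreal ((6 + 2 / \<delta>) * 3)"
        by (rule ennreal_mult[symmetric]) (use \<delta> in auto)
      also have "(6 + 2 / \<delta>) * 3 = 18 + 6 / \<delta>" by (simp add: field_simps)
      finally show ?thesis .
    qed
    ultimately show ?thesis by (metis mult.assoc)
  qed
  finally have "(\<integral>\<^sup>+x\<in>{a<..<b}. backward_max ?D x \<partial>lebesgue) \<le> ennreal 2 * weight w {a<..<b} + ennreal (18 + 6 / \<delta>) * weight w {a<..<b}"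
    by (simp add: add_left_mono)
  also have "\<dots> = ennreal (20 + 6 / \<delta>) * weight w {a<..<b}"
  proof -
    have "ennreal (20 + 6 / \<delta>) = ennreal 2 + ennreal (18 + 6 / \<delta>)"
      by (subst ennreal_plus[symmetric]) (use \<delta> in auto)
    then show ?thesis by (simp only: distrib_right)
  qed
  finally show ?thesis .
qed

lemma weight_bound_imp_A_infty_plus_const_le:
  assumes bd: "one_sided_weight_bound w \<delta>" and \<delta>: "\<delta> > 0"
  shows "A_infty_plus_const w \<le> ennreal (20 + 6 / \<delta>)"
  unfolding A_infty_plus_const_def
proof (rule SUP_least, clarify)
  fix a b :: real assume ab: "a < b"
  let ?X = "\<integral>\<^sup>+x\<in>{a<..<b}. maximal_minus (\<lambda>t. w t * indicator {a<..<b} t) x \<partial>lebesgue"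
  have X: "?X \<le> ennreal (20 + 6 / \<delta>) * weight w {a<..<b}"
    using integral_backward_max_le_of_weight_bound[OF bd \<delta> ab] by (simp add: maximal_minus_eq)
  show "?X / weight w {a<..<b} \<le> ennreal (20 + 6 / \<delta>)"
  proof (cases "weight w {a<..<b} = 0")
    case True
    then show ?thesis using X by simp
  next
    case False
    have "?X / weight w {a<..<b} \<le> ennreal (20 + 6 / \<delta>) * weight w {a<..<b} / weight w {a<..<b}"
      by (rule divide_right_mono_ennreal[OF X])
    also have "\<dots> = ennreal (20 + 6 / \<delta>)"
      using False weight_finite[of "{a<..<b}"] by (simp add: ennreal_times_divide[symmetric])
    finally show ?thesis .
  qed
qed

lemma reverse_Hoelder_of_null:
  assumes null: "\<And>a b. a < b \<Longrightarrow> weight w {a<..<b} = 0"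
  shows "one_sided_reverse_Hoelder w \<epsilon>"
  unfolding one_sided_reverse_Hoelder_def
proof (intro allI impI, elim conjE)
  fix a b c :: real assume "a < b" "b < c"
  have "AE x in lebesgue. x \<in> {a<..<b} \<longrightarrow> w x = 0"
    using null[OF \<open>a < b\<close>] by (rule AE_zero_of_weight_zero)
  then have "(\<integral>\<^sup>+t\<in>{a<..<b}. ennreal (w t powr (1 + \<epsilon>)) \<partial>lebesgue) = (\<integral>\<^sup>+t. 0 \<partial>(lebesgue :: real measure))"
    by (intro nn_integral_cong_AE) (auto elim!: eventually_mono split: split_indicator)
  then show "ennreal (measure lebesgue {b<..<c} powr \<epsilon>) * (\<integral>\<^sup>+t\<in>{a<..<b}. ennreal (w t powr (1 + \<epsilon>)) \<partial>lebesgue)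
      \<le> 2 * ennreal (enn2real (weight w {a<..<c}) powr (1 + \<epsilon>))"
    by simp
qed

lemma weight_bound_of_null:
  assumes null: "\<And>a b. a < b \<Longrightarrow> weight w {a<..<b} = 0"
  shows "one_sided_weight_bound w \<delta>"
  unfolding one_sided_weight_bound_def
proof (intro allI impI, elim conjE)
  fix a b c :: real and E assume "a < b" "b < c" "E \<subseteq> {a<..<b}"
  then have "weight w E = 0" using weight_mono[of E "{a<..<b}"] null[of a b] by simp
  then show "weight w E / weight w {a<..<c} \<le> ennreal (2 * (measure lebesgue E / measure lebesgue {b<..<c}) powr \<delta>)"
    by simp
qed

text \<open>
  For \<open>|E| > |(b, c)|\<close> the bound is trivial, its right-hand side being at least 2.
\<close>

lemma weight_bound_smaller_exponent:
  assumes bd: "one_sided_weight_bound w \<delta>" and \<delta>: "0 \<le> \<delta>'" "\<delta>' \<le> \<delta>"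
  shows "one_sided_weight_bound w \<delta>'"
  unfolding one_sided_weight_bound_def
proof (intro allI impI, elim conjE)
  fix a b c :: real and E assume E: "a < b" "b < c" "E \<in> sets lebesgue" "E \<subseteq> {a<..<b}"
  define R where "R = measure lebesgue E / measure lebesgue {b<..<c}"
  have R: "R \<ge> 0" by (simp add: R_def)
  have le: "weight w E / weight w {a<..<c} \<le> ennreal (2 * R powr \<delta>)"
    using bd E unfolding one_sided_weight_bound_def R_def by blast
  have "weight w E / weight w {a<..<c} \<le> ennreal (2 * R powr \<delta>')"
  proof (cases "R \<le> 1")
    case True
    have "R powr \<delta> \<le> R powr \<delta>'"
      using R True \<delta> by (cases "R = 0") (auto intro: powr_mono')
    then show ?thesis using le by (elim order_trans) (simp add: ennreal_leI)
  next
    case False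
    let ?W = "weight w {a<..<c}"
    have "weight w E / ?W \<le> ?W / ?W"
      using E by (intro divide_right_mono_ennreal weight_mono) auto
    also have "\<dots> \<le> 1"
      using weight_finite[of "{a<..<c}"] by (cases "?W = 0") auto
    also have "\<dots> \<le> ennreal (2 * R powr \<delta>')"
      using False \<delta> ge_one_powr_ge_zero[of R \<delta>'] by simp
    finally show ?thesis .
  qed
  then show "weight w E / weight w {a<..<c} \<le> ennreal (2 * (measure lebesgue E / measure lebesgue {b<..<c}) powr \<delta>')"
    by (simp add: R_def)
qed

lemma A_infty_imp_reverse_Hoelder:
  assumes A: "A_infty_plus w" and \<epsilon>: "\<epsilon> > 0" "ennreal \<epsilon> \<le> 1 / (2 * A_infty_plus_const w)"
  shows "one_sided_reverse_Hoelder w \<epsilon>"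
  using A
proof (cases rule: A_infty_plus_const_cases)
  case null
  then show ?thesis by (intro reverse_Hoelder_of_null) auto
next
  case (ge_1 B)
  have "1 / (2 * ennreal B) = ennreal (1 / (2 * B))"
    using ge_1 by (simp add: divide_ennreal flip: ennreal_1 ennreal_numeral ennreal_mult)
  then have "\<epsilon> \<le> 1 / (2 * B)" using \<epsilon> ge_1 by simp
  then have "\<epsilon> * B \<le> 1 / 2" using ge_1 by (simp add: field_simps)
  then show ?thesis
    unfolding one_sided_reverse_Hoelder_def
    using reverse_Hoelder_interval[OF A ge_1 \<epsilon>(1)] by simp
qed

text \<open>
  For \<open>\<epsilon> = 1 / (2 A)\<close> the exponent \<open>\<epsilon> / (1 + \<epsilon>)\<close> is \<open>1 / (2 A + 1)\<close>, at least \<open>1 / (3 A)\<close> as \<open>A \<ge> 1\<close>.  If \<open>w\<close>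
  vanishes almost everywhere, then \<open>1 / 0 = \<infinity>\<close> has real value 0, and the weight bound holds because its left-hand
  side is 0.
\<close>

lemma A_infty_imp_weight_bound_third:
  assumes A: "A_infty_plus w"
  shows "one_sided_weight_bound w (enn2real (1 / (3 * A_infty_plus_const w)))"
    and "\<lbrakk>ennreal \<epsilon> = 1 / (2 * A_infty_plus_const w); \<epsilon> > 0\<rbrakk>
      \<Longrightarrow> enn2real (1 / (3 * A_infty_plus_const w)) \<le> \<epsilon> / (1 + \<epsilon>)"
proof -
  have "one_sided_weight_bound w (enn2real (1 / (3 * A_infty_plus_const w))) \<and>
    (\<forall>\<epsilon>>0. ennreal \<epsilon> = 1 / (2 * A_infty_plus_const w) \<longrightarrow> enn2real (1 / (3 * A_infty_plus_const w)) \<le> \<epsilon> / (1 + \<epsilon>))"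
    using A
  proof (cases rule: A_infty_plus_const_cases)
    case null
    then show ?thesis using weight_bound_of_null by simp
  next
    case (ge_1 B)
    have two: "1 / (2 * A_infty_plus_const w) = ennreal (1 / (2 * B))"
      using ge_1 by (simp add: divide_ennreal flip: ennreal_1 ennreal_numeral ennreal_mult)
    have "1 / (3 * A_infty_plus_const w) = ennreal (1 / (3 * B))"
      using ge_1 by (simp add: divide_ennreal flip: ennreal_1 ennreal_numeral ennreal_mult)
    then have three: "enn2real (1 / (3 * A_infty_plus_const w)) = 1 / (3 * B)" using ge_1 by simp
    have exp: "1 / (2 * B) / (1 + 1 / (2 * B)) = 1 / (2 * B + 1)" using ge_1 by (simp add: field_simps)
    have le: "1 / (3 * B) \<le> 1 / (2 * B + 1)" using ge_1 by (simp add: field_simps)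
    have "one_sided_reverse_Hoelder w (1 / (2 * B))"
      by (rule A_infty_imp_reverse_Hoelder[OF A]) (use two ge_1 in auto)
    then have "one_sided_weight_bound w (1 / (2 * B) / (1 + 1 / (2 * B)))"
      by (rule reverse_Hoelder_imp_weight_bound) (use ge_1 in simp)
    then have "one_sided_weight_bound w (1 / (2 * B + 1))" unfolding exp .
    then have "one_sided_weight_bound w (1 / (3 * B))"
      by (rule weight_bound_smaller_exponent) (use le ge_1 in auto)
    moreover have "1 / (3 * B) \<le> \<epsilon> / (1 + \<epsilon>)" if "\<epsilon> > 0" "ennreal \<epsilon> = 1 / (2 * A_infty_plus_const w)" for \<epsilon>
    proof -
      have "\<epsilon> = 1 / (2 * B)" using that two ge_1 by simp
      then show ?thesis using exp le by simp
    qed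
    ultimately show ?thesis using three by auto
  qed
  then show "one_sided_weight_bound w (enn2real (1 / (3 * A_infty_plus_const w)))"
    "\<lbrakk>ennreal \<epsilon> = 1 / (2 * A_infty_plus_const w); \<epsilon> > 0\<rbrakk>
      \<Longrightarrow> enn2real (1 / (3 * A_infty_plus_const w)) \<le> \<epsilon> / (1 + \<epsilon>)" by auto
qed

lemma reverse_Hoelder_or_weight_bound_imp_A_infty:
  assumes \<epsilon>: "0 < \<epsilon>" "\<epsilon> < 1"
    and or: "one_sided_reverse_Hoelder w \<epsilon> \<or> one_sided_weight_bound w (\<epsilon> / (1 + \<epsilon>))"
  shows "A_infty_plus_const w \<le> ennreal (32 / \<epsilon>)"
proof -
  have "one_sided_weight_bound w (\<epsilon> / (1 + \<epsilon>))"
    using or reverse_Hoelder_imp_weight_bound \<epsilon>(1) by blast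
  then have "one_sided_weight_bound w (\<epsilon> / 2)"
    by (rule weight_bound_smaller_exponent) (use \<epsilon> in \<open>auto simp: field_simps\<close>)
  then have "A_infty_plus_const w \<le> ennreal (20 + 6 / (\<epsilon> / 2))"
    using \<epsilon> by (intro weight_bound_imp_A_infty_plus_const_le) auto
  also have "\<dots> \<le> ennreal (32 / \<epsilon>)" using \<epsilon> by (intro ennreal_leI) (simp add: field_simps)
  finally show ?thesis .
qed

end

theorem theorem3p2:
  shows "\<exists>C::real. C > 0 \<and>
    (\<forall>w :: real \<Rightarrow> real. (\<forall>x. 0 \<le> w x) \<and> locally_integrable w \<longrightarrow>
      (A_infty_plus w \<longrightarrow>
        (\<forall>\<epsilon>>0. ennreal \<epsilon> \<le> 1 / (2 * A_infty_plus_const w) \<longrightarrow>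
          one_sided_reverse_Hoelder w \<epsilon>))
      \<and>
      (A_infty_plus w \<longrightarrow>
        (\<forall>\<epsilon>>0. ennreal \<epsilon> \<le> 1 / (2 * A_infty_plus_const w) \<longrightarrow>
          one_sided_weight_bound w (\<epsilon> / (1 + \<epsilon>)) \<and>
          one_sided_weight_bound w (enn2real (1 / (3 * A_infty_plus_const w))) \<and>
          (ennreal \<epsilon> = 1 / (2 * A_infty_plus_const w) \<longrightarrow>
            (\<forall>(a::real) b c E. a < b \<and> b < c \<and> E \<in> sets lebesgue \<and> E \<subseteq> {a<..<b} \<and>
                measure lebesgue E \<le> measure lebesgue {b<..<c} \<longrightarrow>
              2 * (measure lebesgue E / measure lebesgue {b<..<c}) powr (\<epsilon> / (1 + \<epsilon>))
              \<le> 2 * (measure lebesgue E / measure lebesgue {b<..<c})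
                    powr (enn2real (1 / (3 * A_infty_plus_const w)))))))
      \<and>
      (\<forall>\<epsilon>. 0 < \<epsilon> \<and> \<epsilon> < 1 \<and>
          (one_sided_reverse_Hoelder w \<epsilon> \<or> one_sided_weight_bound w (\<epsilon> / (1 + \<epsilon>))) \<longrightarrow>
        A_infty_plus w \<and> A_infty_plus_const w \<le> ennreal (C / \<epsilon>)))"
proof (intro exI[of _ 32] conjI allI impI; (elim conjE)?)
  show "(32 :: real) > 0" by simp
next
  fix w :: "real \<Rightarrow> real" and \<epsilon> :: real
  assume "\<forall>x. 0 \<le> w x" "locally_integrable w"
  then interpret weight_function w by unfold_locales auto
  assume *: "A_infty_plus w" "0 < \<epsilon>" "ennreal \<epsilon> \<le> 1 / (2 * A_infty_plus_const w)"
  show RH: "one_sided_reverse_Hoelder w \<epsilon>" by (rule A_infty_imp_reverse_Hoelder[OF *])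
  show "one_sided_weight_bound w (\<epsilon> / (1 + \<epsilon>))" by (rule reverse_Hoelder_imp_weight_bound[OF RH *(2)])
  show "one_sided_weight_bound w (enn2real (1 / (3 * A_infty_plus_const w)))" by (rule A_infty_imp_weight_bound_third[OF *(1)])
  fix a b c :: real and E
  assume eq: "ennreal \<epsilon> = 1 / (2 * A_infty_plus_const w)" and E: "a < b" "b < c"
    "measure lebesgue E \<le> measure lebesgue {b<..<c}"
  define R where "R = measure lebesgue E / measure lebesgue {b<..<c}"
  have "0 \<le> R" "R \<le> 1" using E by (auto simp: R_def)
  then have "R powr (\<epsilon> / (1 + \<epsilon>)) \<le> R powr enn2real (1 / (3 * A_infty_plus_const w))"
    using A_infty_imp_weight_bound_third(2)[OF *(1) eq *(2)] by (cases "R = 0") (auto intro: powr_mono')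
  then show "2 * (measure lebesgue E / measure lebesgue {b<..<c}) powr (\<epsilon> / (1 + \<epsilon>))
    \<le> 2 * (measure lebesgue E / measure lebesgue {b<..<c}) powr (enn2real (1 / (3 * A_infty_plus_const w)))"
    by (simp add: R_def)
next
  fix w :: "real \<Rightarrow> real" and \<epsilon> :: real
  assume "\<forall>x. 0 \<le> w x" "locally_integrable w"
  then interpret weight_function w by unfold_locales auto
  assume *: "0 < \<epsilon>" "\<epsilon> < 1" "one_sided_reverse_Hoelder w \<epsilon> \<or> one_sided_weight_bound w (\<epsilon> / (1 + \<epsilon>))"
  show le: "A_infty_plus_const w \<le> ennreal (32 / \<epsilon>)" by (rule reverse_Hoelder_or_weight_bound_imp_A_infty[OF *])
  show "A_infty_plus w" unfolding A_infty_plus_def using le by (rule le_less_trans) simp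
qed

end
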